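(* There is a distributed algorithm in the CONGEST model that computes a $2$-approximation for unweighted TAP in $O(h)$ rounds, where $h$ is the height of the input tree $T$.
   Context: CONGEST model: network is an undirected connected $n$-vertex graph $G$; synchronous rounds, each vertex sends an $O(\log n)$-bit message per neighbour per round. Unweighted TAP: input is a $2$-edge-connected graph $G$ and a spanning tree $T$ of $G$ rooted at $r$, each vertex knowing its incident tree edges and its parent; the goal is a minimum-cardinality set $Aug$ of edges of $G$ such that $T\cup Aug$ is $2$-edge-connected; each vertex must know which incident edges are in $Aug$. The height $h$ of $T$ is the maximum root-to-vertex distance in $T$. *)

theory Defs
  imports Complex_Main
begin

section \<open>Finite simple graphs\<close>

text \<open>
  A graph is given by a vertex set \<open>V\<close> and a set \<open>E\<close> of two-element subsets of \<open>V\<close>.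
\<close>

definition simple_graph :: "'v set \<Rightarrow> 'v set set \<Rightarrow> bool" where
  "simple_graph V E \<longleftrightarrow> finite V \<and> V \<noteq> {} \<and> (\<forall>e\<in>E. e \<subseteq> V \<and> card e = 2)"

definition adj :: "'v set set \<Rightarrow> 'v rel" where
  "adj E = {(u, v). {u, v} \<in> E}"

definition connected_graph :: "'v set \<Rightarrow> 'v set set \<Rightarrow> bool" where
  "connected_graph V E \<longleftrightarrow> (\<forall>u\<in>V. \<forall>v\<in>V. (u, v) \<in> (adj E)\<^sup>*)"

definition two_edge_connected :: "'v set \<Rightarrow> 'v set set \<Rightarrow> bool" where
  "two_edge_connected V E \<longleftrightarrow>
     connected_graph V E \<and> (\<forall>e\<in>E. connected_graph V (E - {e}))"

definition is_cycle :: "'v set set \<Rightarrow> 'v list \<Rightarrow> bool" where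
  "is_cycle E p \<longleftrightarrow> length p \<ge> 3 \<and> distinct p \<and>
     (\<forall>i<length p. {p ! i, p ! (Suc i mod length p)} \<in> E)"

definition spanning_tree :: "'v set \<Rightarrow> 'v set set \<Rightarrow> 'v set set \<Rightarrow> bool" where
  "spanning_tree V E T \<longleftrightarrow> T \<subseteq> E \<and> connected_graph V T \<and> (\<nexists>p. is_cycle T p)"

text \<open>Distances are only used between vertices of a connected graph.\<close>

definition graph_dist :: "'v set set \<Rightarrow> 'v \<Rightarrow> 'v \<Rightarrow> nat" where
  "graph_dist E u v = (LEAST k. (u, v) \<in> adj E ^^ k)"

definition height :: "'v set \<Rightarrow> 'v set set \<Rightarrow> 'v \<Rightarrow> nat" where
  "height V T r = Max (graph_dist T r ` V)"

definition parent_of :: "'v set set \<Rightarrow> 'v \<Rightarrow> 'v \<Rightarrow> 'v option" where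
  "parent_of T r v =
     (if v = r then None
      else Some (THE u. {u, v} \<in> T \<and> graph_dist T r v = Suc (graph_dist T r u)))"


section \<open>Unweighted tree augmentation\<close>

definition tap_instance :: "'v set \<Rightarrow> 'v set set \<Rightarrow> 'v set set \<Rightarrow> 'v \<Rightarrow> bool" where
  "tap_instance V E T r \<longleftrightarrow>
     simple_graph V E \<and> two_edge_connected V E \<and> spanning_tree V E T \<and> r \<in> V"

definition augmentation :: "'v set \<Rightarrow> 'v set set \<Rightarrow> 'v set set \<Rightarrow> 'v set set \<Rightarrow> bool" where
  "augmentation V E T Aug \<longleftrightarrow> Aug \<subseteq> E \<and> two_edge_connected V (T \<union> Aug)"

definition tap_opt :: "'v set \<Rightarrow> 'v set set \<Rightarrow> 'v set set \<Rightarrow> nat" where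
  "tap_opt V E T = (LEAST k. \<exists>Aug. augmentation V E T Aug \<and> card Aug = k)"

definition tap_approximation ::
  "real \<Rightarrow> 'v set \<Rightarrow> 'v set set \<Rightarrow> 'v set set \<Rightarrow> 'v set set \<Rightarrow> bool" where
  "tap_approximation \<alpha> V E T Aug \<longleftrightarrow>
     augmentation V E T Aug \<and> real (card Aug) \<le> \<alpha> * real (tap_opt V E T)"


section \<open>The CONGEST model\<close>

text \<open>
  A vertex is identified with its natural-number identifier. In each round every vertex picks,
  as a function of its current state, at most one bit string for each neighbour, and then updates
  its state from the messages that arrive; \<open>None\<close> stands for silence. Local computation is
  unrestricted. A vertex has produced its output once \<open>result\<close> is no longer \<open>None\<close>.
\<close>

record ('i, 's, 'o) dist_algorithm =
  init :: "'i \<Rightarrow> 's"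
  send :: "'s \<Rightarrow> nat \<Rightarrow> bool list option"
  receive :: "'s \<Rightarrow> (nat \<Rightarrow> bool list option) \<Rightarrow> 's"
  result :: "'s \<Rightarrow> 'o option"

primrec state_after ::
  "('i, 's, 'o) dist_algorithm \<Rightarrow> nat set set \<Rightarrow> (nat \<Rightarrow> 'i) \<Rightarrow> nat \<Rightarrow> nat \<Rightarrow> 's" where
  "state_after A E inp 0 = (\<lambda>v. init A (inp v))"
| "state_after A E inp (Suc t) =
     (\<lambda>v. receive A (state_after A E inp t v)
        (\<lambda>u. if {u, v} \<in> E then send A (state_after A E inp t u) v else None))"

definition message_size_le ::
  "('i, 's, 'o) dist_algorithm \<Rightarrow> nat set set \<Rightarrow> (nat \<Rightarrow> 'i) \<Rightarrow> real \<Rightarrow> bool" where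
  "message_size_le A E inp b \<longleftrightarrow>
     (\<forall>t u v m. {u, v} \<in> E \<longrightarrow> send A (state_after A E inp t u) v = Some m
        \<longrightarrow> real (length m) \<le> b)"

text \<open>Outputs are irrevocable: the first value a vertex outputs is its final one.\<close>

definition computes_within ::
  "('i, 's, 'o) dist_algorithm \<Rightarrow> nat set \<Rightarrow> nat set set \<Rightarrow> (nat \<Rightarrow> 'i) \<Rightarrow> nat
     \<Rightarrow> (nat \<Rightarrow> 'o) \<Rightarrow> bool" where
  "computes_within A V E inp R out \<longleftrightarrow>
     (\<forall>v\<in>V. \<exists>s\<le>R.
        (\<forall>t<s. result A (state_after A E inp t v) = None) \<and>
        (\<forall>t\<ge>s. result A (state_after A E inp t v) = Some (out v)))"


section \<open>Local inputs and outputs for tree augmentation\<close>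

record tap_input =
  own_id :: nat
  neighbours :: "nat set"
  tree_neighbours :: "nat set"
  parent :: "nat option"

definition tap_local_input :: "nat set set \<Rightarrow> nat set set \<Rightarrow> nat \<Rightarrow> nat \<Rightarrow> tap_input" where
  "tap_local_input E T r v =
     \<lparr> own_id = v,
       neighbours = {u. {u, v} \<in> E},
       tree_neighbours = {u. {u, v} \<in> T},
       parent = parent_of T r v \<rparr>"

text \<open>An edge is named at an endpoint by the identifier of its other endpoint.\<close>

definition incident_part :: "nat set set \<Rightarrow> nat \<Rightarrow> nat set" where
  "incident_part Aug v = {u. {u, v} \<in> Aug}"

text \<open>
  The memory of a vertex is a finite bit string of unbounded length. This is fully general: on
  a finite network, a vertex's local input and any finite history of received messages can be
  encoded in one bit string. The algorithm is uniform: it knows neither the number of vertices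
  nor the height. The constant \<open>k\<close> bounds identifiers by \<open>n ^ k\<close>, that is, to \<open>O(log n)\<close> bits.
\<close>

end

(*
  Bottom up along the tree, a vertex v whose parent edge is not yet covered picks, among the edges
  leaving its subtree, one that reaches highest. Every edge covers at most two parent edges of
  picking vertices, one on either side of the lowest common ancestor of its endpoints, so the
  number of picks is at most twice the optimum.

  Distributedly, every vertex streams the list of its ancestors to all its neighbours in O(h)
  rounds by pipelining. The two endpoints of a non-tree edge then know the depth of their lowest
  common ancestor, so no labelling scheme is needed. A convergecast makes the greedy decisions,
  and a broadcast from the root routes each pick down to the endpoint of the picked edge.
*)
theory Submission
  imports Defs "HOL-Library.Countable"
begin

section \<open>Binary strings\<close>

text \<open>Depth and coverage are both read off from cardinalities: if \<open>x\<close> lies below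
  \<open>v\<close>, a non-tree edge \<open>{x, y}\<close> covers the parent edge of \<open>v\<close>
  iff \<open>x\<close> and \<open>y\<close> have fewer common ancestors than \<open>v\<close> has
  ancestors. So a minimum over all non-tree edges at the subtree suffices, edges inside the subtree
  being harmless, and a report needs only two numbers. The obstacle is that no vertex knows
  \<open>n\<close> or \<open>h\<close>, so phases cannot be separated by counting rounds. Each step
  waits for its data instead; correctness is proved for any round in which a vertex is ready, and
  the time bounds are separate. Streams are complete after \<open>h + 2\<close> rounds, reports are
  ready after \<open>2 * h + 2 - dep v\<close>, decisions after \<open>2 * h + 2 + dep v\<close>,
  and one more round informs the other endpoint of a non-tree edge: at most
  \<open>3 * h + 3\<close>. This is at most \<open>6 * h\<close> unless \<open>h = 0\<close>, where
  the only vertex has to answer before any communication.\<close>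

fun bits :: "nat \<Rightarrow> bool list" where
  "bits n = (if n = 0 then [] else odd n # bits (n div 2))"

declare bits.simps [simp del]

lemma horner_sum_bits: "horner_sum of_bool 2 (bits n) = n"
proof (induction n rule: bits.induct)
  case (1 n)
  then show ?case
    by (cases "n = 0") (simp_all add: bits.simps[of n] bits.simps[of 0] mod_2_eq_odd[symmetric])
qed

lemma inj_bits: "inj bits"
  by (metis horner_sum_bits injI)

lemma two_power_length_bits: "n > 0 \<Longrightarrow> 2 ^ length (bits n) \<le> 2 * n"
proof (induction n rule: bits.induct)
  case (1 n)
  show ?case
  proof (cases "n div 2 = 0")
    case True
    with "1.prems" have "n = 1" by auto
    then show ?thesis by (simp add: bits.simps)
  next
    case False
    with 1 have "2 ^ length (bits (n div 2)) \<le> 2 * (n div 2)" by simp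
    then have "2 ^ length (bits (n div 2)) \<le> n" by linarith
    with "1.prems" show ?thesis by (simp add: bits.simps[of n])
  qed
qed

lemma length_bits_le:
  assumes "2 \<le> n" "m \<le> n ^ K"
  shows "real (length (bits m)) \<le> real (Suc K) * log 2 (real n)"
proof (cases "m = 0")
  case True
  with assms show ?thesis by (simp add: bits.simps)
next
  case False
  have "2 ^ length (bits m) \<le> 2 * m"
    using False by (simp add: two_power_length_bits)
  also have "\<dots> \<le> n ^ Suc K" using assms by (simp add: mult_mono)
  finally have "(2::real) ^ length (bits m) \<le> real n ^ Suc K"
    by (metis of_nat_le_iff of_nat_numeral of_nat_power)
  then have "log 2 (2 ^ length (bits m)) \<le> log 2 (real n ^ Suc K)"
    using assms by (subst log_le_cancel_iff) auto
  then show ?thesis using assms by (simp add: log_nat_power del: power_Suc)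
qed

text \<open>The Cantor pairing of \<open>a\<close> and \<open>b\<close> is at most
  \<open>(a + b + 1)^2\<close>. For \<open>X = n ^ Suc j\<close>, which is at least 2,
  \<open>2 * X + 1\<close> is at most \<open>X ^ 3\<close>, so one pairing multiplies the exponent
  by 6.\<close>

lemma prod_encode_le_power:
  assumes "2 \<le> n" "a \<le> n ^ Suc j" "b \<le> n ^ Suc j"
  shows "prod_encode (a, b) \<le> n ^ (6 * Suc j)"
proof -
  define X where "X = n ^ Suc j"
  have X: "2 \<le> X" "a \<le> X" "b \<le> X"
    using assms power_increasing[of 1 "Suc j" n] by (auto simp: X_def simp del: power_Suc)
  have "prod_encode (a, b) \<le> (a + b + 1)\<^sup>2"
  proof -
    have "triangle (a + b) \<le> (a + b) * Suc (a + b)"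
      by (simp add: triangle_def)
    then show ?thesis by (simp add: prod_encode_def power2_eq_square)
  qed
  also have "\<dots> \<le> (2 * X + 1)\<^sup>2"
    using X by (intro power_mono) auto
  also have "\<dots> \<le> (X ^ 3)\<^sup>2"
  proof (intro power_mono)
    have "2 * X + 1 \<le> 4 * X" using X by simp
    also have "\<dots> \<le> (X * X) * X" using X mult_mono[of 2 X 2 X] by (intro mult_mono) auto
    finally show "2 * X + 1 \<le> X ^ 3" by (simp add: power3_eq_cube)
  qed simp
  finally show ?thesis by (simp add: X_def power_mult[symmetric] mult.commute del: power_Suc)
qed


section \<open>Broadcast algorithms\<close>

text \<open>
  A broadcast algorithm sends the same message to all neighbours, as a function of the local
  input and of the messages received so far, which are listed by sender and latest first.
\<close>

primrec sent ::
  "(tap_input \<Rightarrow> (nat \<Rightarrow> 'm list) \<Rightarrow> 'm) \<Rightarrow> nat set set \<Rightarrow> (nat \<Rightarrow> tap_input)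
     \<Rightarrow> nat \<Rightarrow> nat \<Rightarrow> 'm list" where
  "sent bc E inp 0 = (\<lambda>v. [])"
| "sent bc E inp (Suc t) =
     (\<lambda>v. bc (inp v) (\<lambda>u. if {u, v} \<in> E then sent bc E inp t u else []) # sent bc E inp t v)"

definition inbox ::
  "(tap_input \<Rightarrow> (nat \<Rightarrow> 'm list) \<Rightarrow> 'm) \<Rightarrow> nat set set \<Rightarrow> (nat \<Rightarrow> tap_input)
     \<Rightarrow> nat \<Rightarrow> nat \<Rightarrow> nat \<Rightarrow> 'm list" where
  "inbox bc E inp t v = (\<lambda>u. if {u, v} \<in> E then sent bc E inp t u else [])"

lemma sent_Suc: "sent bc E inp (Suc t) v = bc (inp v) (inbox bc E inp t v) # sent bc E inp t v"
  by (simp add: inbox_def)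

declare sent.simps(2) [simp del]

text \<open>Lists replace the sets and functions of inputs and inboxes, so that the type is
  countable whenever the message type is; \<open>encode_states\<close> relies on this.\<close>

type_synonym 'm store = "(nat \<times> nat list \<times> nat list \<times> nat option) \<times> (nat \<times> 'm list) list"

definition input_of_store :: "'m store \<Rightarrow> tap_input" where
  "input_of_store = (\<lambda>((i, ns, ts, p), _).
     \<lparr>own_id = i, neighbours = set ns, tree_neighbours = set ts, parent = p\<rparr>)"

definition inbox_of_store :: "'m store \<Rightarrow> nat \<Rightarrow> 'm list" where
  "inbox_of_store = (\<lambda>(_, rs) u. case map_of rs u of None \<Rightarrow> [] | Some l \<Rightarrow> l)"

definition store_of :: "tap_input \<Rightarrow> (nat \<Rightarrow> 'm list) \<Rightarrow> 'm store" where
  "store_of i f =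
     ((own_id i, sorted_list_of_set (neighbours i), sorted_list_of_set (tree_neighbours i), parent i),
      map (\<lambda>u. (u, f u)) (sorted_list_of_set (neighbours i)))"

lemma input_of_store_of:
  "finite (neighbours i) \<Longrightarrow> finite (tree_neighbours i) \<Longrightarrow> input_of_store (store_of i f) = i"
  by (simp add: input_of_store_def store_of_def)

lemma inbox_of_store_of:
  "finite (neighbours i) \<Longrightarrow>
     inbox_of_store (store_of i f) = (\<lambda>u. if u \<in> neighbours i then f u else [])"
  by (auto simp: inbox_of_store_def store_of_def map_of_map_restrict fun_eq_iff restrict_map_def)

text \<open>The memory is the input together with the whole history of received messages. No
  neighbour is ever silent, so \<open>the (m u)\<close> is a genuine string and
  \<open>inv code\<close> recovers the message.\<close>

definition broadcast_algorithm ::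
  "(tap_input \<Rightarrow> (nat \<Rightarrow> 'm list) \<Rightarrow> 'm) \<Rightarrow> (tap_input \<Rightarrow> (nat \<Rightarrow> 'm list) \<Rightarrow> 'o option)
     \<Rightarrow> ('m \<Rightarrow> bool list) \<Rightarrow> (tap_input, 'm store, 'o) dist_algorithm" where
  "broadcast_algorithm bc res code =
     \<lparr>init = (\<lambda>i. store_of i (\<lambda>_. [])),
      send = (\<lambda>s _. Some (code (bc (input_of_store s) (inbox_of_store s)))),
      receive = (\<lambda>s m. (fst s, map (\<lambda>(u, l). (u, inv code (the (m u)) # l)) (snd s))),
      result = (\<lambda>s. res (input_of_store s) (inbox_of_store s))\<rparr>"

lemma state_after_broadcast:
  assumes "inj code"
    and "\<And>v. neighbours (inp v) = {u. {u, v} \<in> E}" "\<And>v. finite (neighbours (inp v))"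
    and "\<And>v. finite (tree_neighbours (inp v))"
  shows "state_after (broadcast_algorithm bc res code) E inp t v
           = store_of (inp v) (sent bc E inp t)"
proof (induction t arbitrary: v)
  case 0
  show ?case by (simp add: broadcast_algorithm_def)
next
  case (Suc t)
  have fin: "finite {u. {u, v} \<in> E}" for v using assms(2,3) by metis
  show ?case
    unfolding state_after.simps Suc.IH
    using assms(1,2,4) fin
    by (auto simp: sent.simps(2) broadcast_algorithm_def input_of_store_of inbox_of_store_of store_of_def[of "inp v"])
qed

text \<open>Conjugation with an injection of the countable state type into bit strings;
  \<open>horner_sum\<close> undoes \<open>bits\<close>. Messages and results stay the same.\<close>

definition encode_states ::
  "('i, 's::countable, 'o) dist_algorithm \<Rightarrow> ('i, bool list, 'o) dist_algorithm" where
  "encode_states A =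
     (let enc = (\<lambda>s. bits (to_nat s)); dec = (\<lambda>w. from_nat (horner_sum of_bool 2 w)) in
     \<lparr>init = (\<lambda>i. enc (init A i)),
      send = (\<lambda>w. send A (dec w)),
      receive = (\<lambda>w m. enc (receive A (dec w) m)),
      result = (\<lambda>w. result A (dec w))\<rparr>)"

lemma state_after_encode_states:
  "state_after (encode_states A) E inp t v = bits (to_nat (state_after A E inp t v))"
  by (induction t arbitrary: v) (simp_all add: encode_states_def horner_sum_bits cong: if_cong)

text \<open>\<open>A\<close> is obtained before the network is fixed, which gives uniformity. It
  lets an execution be analysed through \<open>inbox\<close> alone, without memories.\<close>

lemma broadcast_realizable:
  fixes bc :: "tap_input \<Rightarrow> (nat \<Rightarrow> 'm::countable list) \<Rightarrow> 'm"
    and res :: "tap_input \<Rightarrow> (nat \<Rightarrow> 'm list) \<Rightarrow> 'o option"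
  assumes "inj code"
  obtains A :: "(tap_input, bool list, 'o) dist_algorithm" where
    "\<And>E inp t u v.
       (\<And>v. neighbours (inp v) = {u. {u, v} \<in> E} \<and> finite (neighbours (inp v)) \<and>
          finite (tree_neighbours (inp v))) \<Longrightarrow>
       send A (state_after A E inp t v) u = Some (code (bc (inp v) (inbox bc E inp t v))) \<and>
       result A (state_after A E inp t v) = res (inp v) (inbox bc E inp t v)"
proof
  let ?B = "broadcast_algorithm bc res code"
  fix E and inp :: "nat \<Rightarrow> tap_input" and t u v
  assume inp: "\<And>v. neighbours (inp v) = {u. {u, v} \<in> E} \<and> finite (neighbours (inp v)) \<and>
          finite (tree_neighbours (inp v))"
  have st: "state_after ?B E inp t v = store_of (inp v) (sent bc E inp t)"
    using inp[THEN conjunct1] inp[THEN conjunct2, THEN conjunct1] inp[THEN conjunct2, THEN conjunct2]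
    by (rule state_after_broadcast[OF assms])
  have "finite {u. {u, v} \<in> E}" using inp by metis
  then have "inbox_of_store (store_of (inp v) (sent bc E inp t)) = inbox bc E inp t v"
    using inp by (subst inbox_of_store_of) (auto simp: inbox_def)
  moreover have "input_of_store (store_of (inp v) (sent bc E inp t)) = inp v"
    using inp[of v] by (intro input_of_store_of) auto
  ultimately show "send (encode_states ?B) (state_after (encode_states ?B) E inp t v) u
        = Some (code (bc (inp v) (inbox bc E inp t v))) \<and>
      result (encode_states ?B) (state_after (encode_states ?B) E inp t v)
        = res (inp v) (inbox bc E inp t v)"
    unfolding state_after_encode_states st
    by (simp add: encode_states_def horner_sum_bits broadcast_algorithm_def)
qed

section \<open>Rooted spanning trees\<close>

lemma adj_commute: "(u, v) \<in> adj E \<longleftrightarrow> (v, u) \<in> adj E"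
  by (simp add: adj_def insert_commute)

lemma sym_rtrancl_adj: "(u, v) \<in> (adj E)\<^sup>* \<Longrightarrow> (v, u) \<in> (adj E)\<^sup>*"
  by (meson adj_commute sym_def sym_rtrancl)

lemma rtrancl_adj_mono: "(u, v) \<in> (adj E)\<^sup>* \<Longrightarrow> E \<subseteq> F \<Longrightarrow> (u, v) \<in> (adj F)\<^sup>*"
  by (rule subsetD[OF rtrancl_mono]) (auto simp: adj_def)

text \<open>Induction prepends a vertex to a simple path; if that vertex already occurs, the path is
  cut to the suffix starting there.\<close>

lemma rtrancl_adj_simple_path:
  assumes "(u, v) \<in> (adj E)\<^sup>*"
  obtains p where "p \<noteq> []" "hd p = u" "last p = v" "distinct p"
    "successively (\<lambda>x y. {x, y} \<in> E) p"
  using assms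
proof (induction arbitrary: thesis rule: converse_rtrancl_induct)
  case base
  show ?case by (rule base[of "[v]"]) auto
next
  case (step u w)
  obtain p where p: "p \<noteq> []" "hd p = w" "last p = v" "distinct p"
    "successively (\<lambda>x y. {x, y} \<in> E) p"
    using step.IH by blast
  show ?case
  proof (cases "u \<in> set p")
    case True
    then obtain xs ys where "p = xs @ u # ys" by (meson split_list)
    with p show ?thesis
      by (intro step.prems[of "u # ys"]) (auto simp: successively_append_iff)
  next
    case False
    with p step.hyps show ?thesis
      by (intro step.prems[of "u # p"]) (auto simp: successively_Cons adj_def)
  qed
qed

text \<open>A simple path from \<open>u\<close> to \<open>v\<close> that avoids the edge would be
  closed to a cycle by it. Length 1 is excluded by \<open>u \<noteq> v\<close>, length 2 because the
  edge was removed.\<close>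

lemma acyclic_edge_is_bridge:
  assumes acyc: "\<nexists>p. is_cycle T p" and uv: "{u, v} \<in> T" "u \<noteq> v"
  shows "(u, v) \<notin> (adj (T - {{u, v}}))\<^sup>*"
proof
  assume "(u, v) \<in> (adj (T - {{u, v}}))\<^sup>*"
  then obtain p where p: "p \<noteq> []" "hd p = u" "last p = v" "distinct p"
    and suc: "successively (\<lambda>x y. {x, y} \<in> T - {{u, v}}) p"
    by (rule rtrancl_adj_simple_path)
  have "length p \<noteq> 1"
    using p uv by (auto simp: length_Suc_conv)
  moreover have "length p \<noteq> 2"
    using p suc by (auto simp: length_Suc_conv numeral_2_eq_2)
  moreover have "length p > 0" using p by simp
  ultimately have len: "3 \<le> length p" by linarith
  have "{p ! i, p ! (Suc i mod length p)} \<in> T" if i: "i < length p" for i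
  proof (cases "Suc i = length p")
    case True
    then have "p ! i = v" "p ! (Suc i mod length p) = u"
      using p by (auto simp: last_conv_nth hd_conv_nth True[symmetric])
    then show ?thesis using uv by (simp add: insert_commute)
  next
    case False
    then show ?thesis using i suc by (auto simp: successively_conv_nth)
  qed
  then have "is_cycle T p" using len p by (simp add: is_cycle_def)
  with acyc show False by blast
qed

section \<open>Depths and parents in a rooted spanning tree\<close>

locale tap =
  fixes V :: "nat set" and E T :: "nat set set" and r :: nat
  assumes instance_tap: "tap_instance V E T r"
begin

abbreviation dep :: "nat \<Rightarrow> nat" where
  "dep \<equiv> graph_dist T r"

definition par :: "nat \<Rightarrow> nat" where
  "par v = the (parent_of T r v)"

abbreviation h :: nat where
  "h \<equiv> height V T r"

lemma finite_V: "finite V" and root_in_V: "r \<in> V"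
  and tree_subset: "T \<subseteq> E" and graph_2ec: "two_edge_connected V E"
  and tree_connected: "connected_graph V T" and tree_acyclic: "\<nexists>p. is_cycle T p"
  using instance_tap
  by (auto simp: tap_instance_def simple_graph_def spanning_tree_def)

lemma edge_D: "{u, v} \<in> E \<Longrightarrow> u \<in> V \<and> v \<in> V \<and> u \<noteq> v"
  using instance_tap by (force simp: tap_instance_def simple_graph_def)

lemma edge_card: "e \<in> E \<Longrightarrow> card e = 2"
  using instance_tap by (force simp: tap_instance_def simple_graph_def)

lemma tree_edge_D: "{u, v} \<in> T \<Longrightarrow> u \<in> V \<and> v \<in> V \<and> u \<noteq> v"
  using edge_D tree_subset by blast

lemma finite_E: "finite E"
proof (rule finite_subset)
  show "E \<subseteq> Pow V"
    using instance_tap by (auto simp: tap_instance_def simple_graph_def)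
qed (simp add: finite_V)

lemma dep_walk: "v \<in> V \<Longrightarrow> (r, v) \<in> adj T ^^ dep v"
  unfolding graph_dist_def
  by (rule LeastI_ex, rule rtrancl_imp_relpow)
     (use tree_connected root_in_V in \<open>auto simp: connected_graph_def\<close>)

lemma dep_le: "(r, v) \<in> adj T ^^ k \<Longrightarrow> dep v \<le> k"
  unfolding graph_dist_def by (rule Least_le)

lemma dep_root [simp]: "dep r = 0"
  using dep_le[of r 0] by simp

lemma dep_eq_0: "v \<in> V \<Longrightarrow> dep v = 0 \<longleftrightarrow> v = r"
  using dep_walk[of v] by auto

lemma dep_edge_le: "{u, v} \<in> T \<Longrightarrow> dep v \<le> Suc (dep u)"
  using dep_walk[of u] tree_edge_D[of u v] by (intro dep_le) (auto simp: adj_def)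

lemma lower_neighbour:
  assumes "v \<in> V" "v \<noteq> r"
  obtains u where "{u, v} \<in> T" "dep v = Suc (dep u)"
proof -
  obtain d where d: "dep v = Suc d" using assms dep_eq_0 not0_implies_Suc by blast
  then obtain u where u: "(r, u) \<in> adj T ^^ d" "(u, v) \<in> adj T"
    using dep_walk[OF assms(1)] by auto
  then have "dep v = Suc (dep u)"
    using d dep_le[OF u(1)] dep_edge_le[of u v] by (simp add: adj_def)
  with u that show thesis by (simp add: adj_def)
qed

text \<open>Walk to ever smaller depth. Such a step uses \<open>{u, v}\<close> only when it leaves
  \<open>v\<close>, or leaves \<open>u\<close> for a \<open>v\<close> of smaller depth; both are
  excluded.\<close>

lemma root_walk_avoiding:
  assumes uv: "{u, v} \<in> T" "dep u \<le> dep v"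
  shows "x \<in> V \<Longrightarrow> dep x \<le> dep v \<Longrightarrow> x \<noteq> v \<Longrightarrow> (x, r) \<in> (adj (T - {{u, v}}))\<^sup>*"
proof (induction "dep x" arbitrary: x rule: less_induct)
  case less
  show ?case
  proof (cases "x = r")
    case False
    then obtain y where y: "{y, x} \<in> T" "dep x = Suc (dep y)"
      using less.prems lower_neighbour by blast
    then have "(y, r) \<in> (adj (T - {{u, v}}))\<^sup>*"
      using less tree_edge_D[OF y(1)] by (intro less.hyps) auto
    moreover have "{y, x} \<noteq> {u, v}"
      using y uv less.prems by (auto simp: doubleton_eq_iff)
    with y have "(x, y) \<in> adj (T - {{u, v}})"
      by (auto simp: adj_def insert_commute)
    ultimately show ?thesis by (rule converse_rtrancl_into_rtrancl[rotated])
  qed simp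
qed

text \<open>Otherwise \<open>u\<close>, the root, \<open>w\<close> and \<open>v\<close> would be
  joined without the edge \<open>{u, v}\<close>, which is a bridge. As only
  \<open>dep u \<le> dep v\<close> is assumed, edges between vertices of equal depth are excluded as
  well.\<close>

lemma lower_neighbour_unique:
  assumes uv: "{u, v} \<in> T" "dep u \<le> dep v" and w: "{w, v} \<in> T" "dep v = Suc (dep w)"
  shows "u = w"
proof (rule ccontr)
  assume "u \<noteq> w"
  let ?F = "adj (T - {{u, v}})"
  have "(w, v) \<in> ?F" using w \<open>u \<noteq> w\<close> by (auto simp: adj_def doubleton_eq_iff)
  moreover have "(u, r) \<in> ?F\<^sup>*" "(w, r) \<in> ?F\<^sup>*"
    using uv w tree_edge_D[OF uv(1)] tree_edge_D[OF w(1)]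
    by (auto intro!: root_walk_avoiding[OF uv])
  ultimately have "(u, v) \<in> ?F\<^sup>*"
    by (meson sym_rtrancl_adj rtrancl_trans rtrancl.rtrancl_into_rtrancl)
  then show False
    using acyclic_edge_is_bridge[OF tree_acyclic uv(1)] tree_edge_D[OF uv(1)] by blast
qed

lemma parent_of_root: "parent_of T r r = None"
  by (simp add: parent_of_def)

lemma par_unique:
  assumes "v \<noteq> r" "{u, v} \<in> T" "dep v = Suc (dep u)"
  shows "parent_of T r v = Some u"
proof -
  have "(THE u. {u, v} \<in> T \<and> dep v = Suc (dep u)) = u"
    using assms lower_neighbour_unique by (intro the_equality) auto
  with assms show ?thesis by (simp add: parent_of_def)
qed

lemma
  assumes "v \<in> V" "v \<noteq> r"
  shows parent_of_eq: "parent_of T r v = Some (par v)"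
    and par_edge: "{par v, v} \<in> T"
    and dep_par: "dep v = Suc (dep (par v))"
    and par_in_V: "par v \<in> V"
proof -
  obtain u where u: "{u, v} \<in> T" "dep v = Suc (dep u)"
    using assms lower_neighbour by blast
  then have "parent_of T r v = Some u" using assms par_unique by blast
  with u tree_edge_D[OF u(1)]
  show "parent_of T r v = Some (par v)" "{par v, v} \<in> T" "dep v = Suc (dep (par v))" "par v \<in> V"
    by (auto simp: par_def)
qed

lemma tree_edge_cases:
  assumes "{u, v} \<in> T"
  shows "v \<noteq> r \<and> u = par v \<or> u \<noteq> r \<and> v = par u"
proof -
  have *: "v \<noteq> r \<and> u = par v" if uv: "{u, v} \<in> T" "dep u \<le> dep v" for u v
  proof -
    have v: "v \<noteq> r" using uv dep_eq_0[of u] tree_edge_D[OF uv(1)] by auto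
    then show ?thesis
      using uv lower_neighbour_unique[OF uv, of "par v"] tree_edge_D[OF uv(1)]
        par_edge[of v] dep_par[of v] by auto
  qed
  show ?thesis
    using *[of u v] *[of v u] assms by (cases "dep u \<le> dep v") (auto simp: insert_commute)
qed

lemma dep_le_h: "v \<in> V \<Longrightarrow> dep v \<le> h"
  unfolding height_def by (rule Max_ge) (auto simp: finite_V)


subsection \<open>Ancestors\<close>

text \<open>The iteration stops at \<open>dep v\<close>, where the root is reached, because
  \<open>par r\<close> is \<open>the None\<close>.\<close>

definition anc :: "nat \<Rightarrow> nat set" where
  "anc v = (\<lambda>i. (par ^^ i) v) ` {..dep v}"

lemma anc_root [simp]: "anc r = {r}"
  by (simp add: anc_def)

lemma anc_refl: "v \<in> anc v"
  unfolding anc_def by (rule image_eqI[of _ _ 0]) auto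

lemma finite_anc: "finite (anc v)"
  by (simp add: anc_def)

lemma anc_unfold:
  assumes "v \<in> V" "v \<noteq> r"
  shows "anc v = insert v (anc (par v))"
proof -
  have "{..dep v} = insert 0 (Suc ` {..dep (par v)})"
    using dep_par[OF assms] by (metis atMost_Suc_eq_insert_0)
  then show ?thesis
    by (simp add: anc_def image_image funpow_Suc_right del: image_Suc_atMost funpow.simps(2))
qed

lemma anc_parI:
  assumes "x \<in> V" "v \<in> anc x" "x \<noteq> v"
  shows "x \<noteq> r \<and> v \<in> anc (par x)"
proof -
  have "x \<noteq> r" using assms by auto
  then show ?thesis using assms anc_unfold[of x] by auto
qed

lemma dep_par_power:
  assumes "v \<in> V" "i \<le> dep v"
  shows "(par ^^ i) v \<in> V \<and> dep ((par ^^ i) v) = dep v - i"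
  using assms(2)
proof (induction i)
  case (Suc i)
  then have "(par ^^ i) v \<in> V" "dep ((par ^^ i) v) = dep v - i" "(par ^^ i) v \<noteq> r"
    using dep_root by (auto simp del: dep_root)
  then show ?case
    using par_in_V[of "(par ^^ i) v"] dep_par[of "(par ^^ i) v"] by auto
qed (simp add: assms)

lemma anc_D: "v \<in> V \<Longrightarrow> a \<in> anc v \<Longrightarrow> a \<in> V \<and> dep a \<le> dep v"
  using dep_par_power by (fastforce simp: anc_def)

lemma anc_trans:
  assumes "v \<in> V" "a \<in> anc v"
  shows "anc a \<subseteq> anc v"
proof -
  obtain i where i: "i \<le> dep v" "a = (par ^^ i) v" using assms by (auto simp: anc_def)
  then have dep: "dep a = dep v - i" using dep_par_power assms by blast
  show ?thesis
  proof
    fix b assume "b \<in> anc a"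
    then obtain j where "j \<le> dep a" "b = (par ^^ j) a" by (auto simp: anc_def)
    then have "b = (par ^^ (j + i)) v" "j + i \<le> dep v" using i dep by (auto simp: funpow_add)
    then show "b \<in> anc v" by (auto simp: anc_def)
  qed
qed

lemma anc_chain:
  assumes "v \<in> V" "a \<in> anc v" "b \<in> anc v"
  shows "a \<in> anc b \<or> b \<in> anc a"
proof -
  have *: "(par ^^ j) v \<in> anc ((par ^^ i) v)" if "i \<le> j" "j \<le> dep v" for i j
  proof -
    have "(par ^^ j) v = (par ^^ (j - i)) ((par ^^ i) v)"
      using that funpow_add[of "j - i" i par] by simp
    then show ?thesis
      using that assms dep_par_power[of v i] by (auto simp: anc_def intro!: image_eqI)
  qed
  obtain i j where "i \<le> dep v" "j \<le> dep v" "a = (par ^^ i) v" "b = (par ^^ j) v"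
    using assms by (auto simp: anc_def)
  then show ?thesis using *[of i j] *[of j i] by (cases "i \<le> j") auto
qed

lemma root_in_anc: 
  assumes "v \<in> V" shows "r \<in> anc v"
  using dep_par_power[OF assms, of "dep v"] dep_eq_0
  by (auto simp: anc_def intro!: image_eqI[of _ _ "dep v"])

text \<open>The test for coverage in terms of numbers. A common ancestor \<open>v\<close> brings all
  of \<open>anc v\<close> along. If \<open>v\<close> is not one, then, \<open>anc x\<close> being a
  chain and the common ancestors being closed upwards, they all lie strictly above
  \<open>v\<close>.\<close>

lemma common_anc_less_iff:
  assumes "x \<in> V" "y \<in> V" "v \<in> anc x"
  shows "card (anc x \<inter> anc y) < card (anc v) \<longleftrightarrow> v \<notin> anc y"
proof
  assume less: "card (anc x \<inter> anc y) < card (anc v)"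
  show "v \<notin> anc y"
  proof
    assume "v \<in> anc y"
    then have "anc v \<subseteq> anc x \<inter> anc y" using assms anc_trans by auto
    then have "card (anc v) \<le> card (anc x \<inter> anc y)"
      by (intro card_mono) (auto simp: finite_anc)
    with less show False by simp
  qed
next
  assume v: "v \<notin> anc y"
  have "anc x \<inter> anc y \<subseteq> anc v - {v}"
  proof
    fix z assume z: "z \<in> anc x \<inter> anc y"
    then have "z \<in> anc v \<or> v \<in> anc z" using anc_chain assms by auto
    moreover have "anc z \<subseteq> anc y" using z assms anc_trans by auto
    ultimately show "z \<in> anc v - {v}" using v z by auto
  qed
  then have "anc x \<inter> anc y \<subset> anc v" using anc_refl by blast
  then show "card (anc x \<inter> anc y) < card (anc v)"
    by (intro psubset_card_mono) (auto simp: finite_anc)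
qed

section \<open>Children, non-tree edges and one step of descent\<close>

definition children :: "nat \<Rightarrow> nat set" where
  "children v = {w \<in> V. w \<noteq> r \<and> par w = v}"

definition cross :: "nat \<Rightarrow> nat set" where
  "cross v = {u. {u, v} \<in> E - T}"

lemma finite_children: "finite (children v)"
  by (simp add: children_def finite_V)

lemma cross_D: "u \<in> cross v \<Longrightarrow> u \<in> V \<and> v \<in> V \<and> u \<noteq> v"
  using edge_D by (auto simp: cross_def)

lemma finite_cross: "finite (cross v)"
  using cross_D finite_V by (metis finite_subset subsetI)

lemma cross_commute: "u \<in> cross v \<longleftrightarrow> v \<in> cross u"
  by (simp add: cross_def insert_commute)

lemma children_D:
  assumes "w \<in> children v"
  shows "w \<in> V" "w \<noteq> r" "v \<in> V" "par w = v" "dep w = Suc (dep v)" "anc w = insert w (anc v)"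
    "{w, v} \<in> T"
  using assms par_in_V[of w] dep_par[of w] anc_unfold[of w] par_edge[of w]
  by (auto simp: children_def insert_commute)

lemma children_not_cross: "w \<in> children v \<Longrightarrow> w \<notin> cross v"
  using children_D(7) by (auto simp: cross_def)

lemma children_eq:
  assumes "v \<in> V"
  shows "children v = {u. {u, v} \<in> T} - set_option (parent_of T r v)"
proof (intro equalityI subsetI)
  fix u assume u: "u \<in> children v"
  have "parent_of T r v \<noteq> Some u"
  proof (cases "v = r")
    case False
    then show ?thesis
      using children_D(5)[OF u] dep_par[OF assms] parent_of_eq[OF assms] by auto
  qed (simp add: parent_of_root)
  then show "u \<in> {u. {u, v} \<in> T} - set_option (parent_of T r v)"
    using children_D(7)[OF u] by auto
next
  fix u assume "u \<in> {u. {u, v} \<in> T} - set_option (parent_of T r v)"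
  then show "u \<in> children v"
    using tree_edge_cases[of u v] tree_edge_D[of u v] parent_of_eq[OF assms]
    by (auto simp: children_def)
qed

lemma descend:
  assumes "x \<in> V" "v \<in> anc x" "v \<noteq> x"
  obtains w where "w \<in> children v" "w \<in> anc x"
proof -
  obtain i where i: "i \<le> dep x" "v = (par ^^ i) x" using assms by (auto simp: anc_def)
  then obtain j where j: "i = Suc j" using assms by (cases i) auto
  let ?w = "(par ^^ j) x"
  have "?w \<in> V" "dep ?w = dep x - j" "?w \<in> anc x"
    using i j dep_par_power[OF assms(1), of j] by (auto simp: anc_def)
  moreover then have "?w \<noteq> r" using i j by (auto simp: dep_eq_0[symmetric] simp del: dep_root)
  ultimately show thesis using that i j by (auto simp: children_def)
qed


subsection \<open>Augmentations are covers of the tree edges\<close>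

text \<open>The vertex \<open>v\<close> stands for its parent edge. \<open>v \<in> anc x\<close>
  says that \<open>x\<close> is in the subtree of \<open>v\<close>, so the edge required is a
  non-tree edge leaving that subtree.\<close>

definition covered :: "nat set set \<Rightarrow> nat \<Rightarrow> bool" where
  "covered F v \<longleftrightarrow> (\<exists>x y. {x, y} \<in> F - T \<and> v \<in> anc x \<and> v \<notin> anc y)"

text \<open>A walk from \<open>v\<close> to the root without the parent edge must leave the subtree
  of \<open>v\<close> somewhere, and the parent edge is the only tree edge that does so.\<close>

lemma two_edge_connected_covered:
  assumes tec: "two_edge_connected V F" and F: "T \<subseteq> F" "F \<subseteq> E" and v: "v \<in> V" "v \<noteq> r"
  shows "covered F v"
proof -
  let ?e = "{par v, v}"
  have "connected_graph V (F - {?e})"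
    using tec F par_edge[OF v] by (auto simp: two_edge_connected_def)
  then have "(v, r) \<in> (adj (F - {?e}))\<^sup>*"
    using v root_in_V by (auto simp: connected_graph_def)
  moreover have "\<exists>x y. (x, y) \<in> adj (F - {?e}) \<and> v \<in> anc x \<and> v \<notin> anc y"
    if "(z, r) \<in> (adj (F - {?e}))\<^sup>*" "v \<in> anc z" for z
    using that
  proof (induction rule: converse_rtrancl_induct)
    case base
    then show ?case using v by simp
  qed blast
  ultimately have "\<exists>x y. (x, y) \<in> adj (F - {?e}) \<and> v \<in> anc x \<and> v \<notin> anc y"
    using anc_refl by blast
  then obtain x y where xy: "{x, y} \<in> F - {?e}" "v \<in> anc x" "v \<notin> anc y"
    by (auto simp: adj_def)
  have "{x, y} \<notin> T"
  proof
    assume T: "{x, y} \<in> T"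
    note V = tree_edge_D[OF T]
    show False
    proof (cases "y \<noteq> r \<and> x = par y")
      case True
      then show ?thesis using xy V anc_unfold[of y] by auto
    next
      case False
      then have "x \<noteq> r" "y = par x" using tree_edge_cases[OF T] by auto
      then show ?thesis using xy V anc_unfold[of x] by (auto simp: insert_commute)
    qed
  qed
  with xy show ?thesis by (auto simp: covered_def)
qed

text \<open>Without a non-tree edge, \<open>T\<close> still connects everything. Without the parent
  edge of \<open>v\<close>, vertices below \<open>v\<close> climb to \<open>v\<close>, the others
  climb to the root, and a covering edge joins the two sides.\<close>

lemma covered_two_edge_connected:
  assumes F: "T \<subseteq> F" "F \<subseteq> E" and cov: "\<And>v. v \<in> V \<Longrightarrow> v \<noteq> r \<Longrightarrow> covered F v"
  shows "two_edge_connected V F"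
proof -
  have connI: "connected_graph V G" if "\<And>x. x \<in> V \<Longrightarrow> (x, r) \<in> (adj G)\<^sup>*" for G
    unfolding connected_graph_def
  proof (intro ballI)
    fix x y assume "x \<in> V" "y \<in> V"
    then show "(x, y) \<in> (adj G)\<^sup>*"
      by (rule rtrancl_trans[OF that sym_rtrancl_adj[OF that]])
  qed
  have conn: "connected_graph V G" if "T \<subseteq> G" for G
    using tree_connected rtrancl_adj_mono[OF _ that] unfolding connected_graph_def by blast
  have "connected_graph V (F - {e})" if "e \<in> F" for e
  proof (cases "e \<in> T")
    case False
    with F show ?thesis by (intro conn) auto
  next
    case True
    obtain a b where ab: "e = {a, b}"
      using True tree_subset edge_card by (meson card_2_iff subsetD)
    have "b \<noteq> r \<and> a = par b \<or> a \<noteq> r \<and> b = par a" "a \<in> V" "b \<in> V"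
      using tree_edge_cases[of a b] tree_edge_D[of a b] True ab by blast+
    then obtain v where v: "v \<in> V" "v \<noteq> r" "e = {par v, v}"
      using ab by (metis insert_commute)
    let ?G = "adj (F - {e})"
    have par_step: "(x, par x) \<in> ?G" if x: "x \<in> V" "x \<noteq> r" "x \<noteq> v" for x
    proof -
      have "{x, par x} \<noteq> e"
        using x v dep_par[of x] dep_par[of v] by (metis doubleton_eq_iff n_not_Suc_n Suc_n_not_le_n le_SucI order_refl)
      then show ?thesis using F par_edge[OF x(1,2)] by (simp add: adj_def insert_commute subset_iff)
    qed
    have below: "(x, v) \<in> ?G\<^sup>*" if "x \<in> V" "v \<in> anc x" for x
      using that
    proof (induction "dep x" arbitrary: x rule: less_induct)
      case less
      show ?case
      proof (cases "x = v")
        case False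
        moreover have "x \<noteq> r"
          using less.prems v by auto
        ultimately have "x \<noteq> r" "v \<in> anc (par x)"
          using less.prems anc_unfold[of x] by auto
        then show ?thesis
          using False less par_step[of x] par_in_V[of x] dep_par[of x]
          by (intro converse_rtrancl_into_rtrancl[of x "par x"]) auto
      qed simp
    qed
    have above: "(x, r) \<in> ?G\<^sup>*" if "x \<in> V" "v \<notin> anc x" for x
      using that
    proof (induction "dep x" arbitrary: x rule: less_induct)
      case less
      show ?case
      proof (cases "x = r")
        case False
        then have "x \<noteq> v" "v \<notin> anc (par x)"
          using less.prems anc_unfold[of x] by auto
        then show ?thesis
          using False less par_step[of x] par_in_V[of x] dep_par[of x]
          by (intro converse_rtrancl_into_rtrancl[of x "par x"]) auto
      qed simp
    qed
    obtain x y where xy: "{x, y} \<in> F - T" "v \<in> anc x" "v \<notin> anc y"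
      using cov[OF v(1,2)] by (auto simp: covered_def)
    then have V: "x \<in> V" "y \<in> V" using edge_D F by blast+
    have "(x, y) \<in> ?G" using xy True by (auto simp: adj_def)
    moreover have "(v, x) \<in> ?G\<^sup>*"
      by (rule sym_rtrancl_adj[OF below[OF V(1) xy(2)]])
    ultimately have "(v, y) \<in> ?G\<^sup>*" by (rule rtrancl.rtrancl_into_rtrancl[rotated])
    then have "(v, r) \<in> ?G\<^sup>*"
      by (rule rtrancl_trans[OF _ above[OF V(2) xy(3)]])
    then have "(x, r) \<in> ?G\<^sup>*" if "x \<in> V" for x
      using above[OF that] rtrancl_trans[OF below[OF that]] by blast
    then show ?thesis by (rule connI)
  qed
  then show ?thesis using conn[OF F(1)] by (simp add: two_edge_connected_def)
qed

lemma augmentation_iff: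
  "augmentation V E T F \<longleftrightarrow> F \<subseteq> E \<and> (\<forall>v\<in>V - {r}. covered F v)"
proof -
  have "covered (T \<union> F) = covered F"
    by (simp add: covered_def Un_Diff fun_eq_iff)
  moreover have "two_edge_connected V (T \<union> F) \<longleftrightarrow> (\<forall>v\<in>V - {r}. covered (T \<union> F) v)"
    if "F \<subseteq> E"
  proof
    assume "two_edge_connected V (T \<union> F)"
    then show "\<forall>v\<in>V - {r}. covered (T \<union> F) v"
      using that tree_subset two_edge_connected_covered[of "T \<union> F"] by blast
  next
    assume "\<forall>v\<in>V - {r}. covered (T \<union> F) v"
    then show "two_edge_connected V (T \<union> F)"
      using that tree_subset by (intro covered_two_edge_connected) blast+
  qed
  ultimately show ?thesis unfolding augmentation_def by metis
qed

end

section \<open>The greedy cover\<close>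

text \<open>
  The arguments of the following functions are what a vertex knows locally: the endpoints \<open>N\<close> of
  its non-tree edges, its children \<open>C\<close>, its ancestors \<open>X\<close>, the ancestors \<open>a u\<close> of \<open>u \<in> N\<close>, and
  the reports \<open>b w\<close> of \<open>w \<in> C\<close>. The value of an edge is the number of common ancestors of its
  endpoints, that is, one more than the depth of their lowest common ancestor. A report consists
  of the least value of an edge that leaves the subtree, and of the least value of such an edge
  chosen so far.
\<close>

definition edge_val ::
  "nat set \<Rightarrow> nat set \<Rightarrow> (nat \<Rightarrow> nat set) \<Rightarrow> (nat \<Rightarrow> nat \<times> nat) \<Rightarrow> nat \<Rightarrow> nat" where
  "edge_val N X a b u = (if u \<in> N then card (X \<inter> a u) else fst (b u))"

definition best ::
  "nat set \<Rightarrow> nat set \<Rightarrow> nat set \<Rightarrow> (nat \<Rightarrow> nat set) \<Rightarrow> (nat \<Rightarrow> nat \<times> nat) \<Rightarrow> nat" where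
  "best N C X a b = arg_min_on (edge_val N X a b) (N \<union> C)"

text \<open>By \<open>common_anc_less_iff\<close>, an edge chosen below \<open>w\<close> covers the
  current parent edge iff its value is less than \<open>card X\<close>. When the test fails, it
  provides a child, so the \<open>Min\<close> in \<open>report\<close> ranges over a nonempty
  set.\<close>

definition uncovered :: "nat set \<Rightarrow> nat set \<Rightarrow> (nat \<Rightarrow> nat \<times> nat) \<Rightarrow> bool" where
  "uncovered C X b \<longleftrightarrow> (\<forall>w\<in>C. card X \<le> snd (b w))"

definition report ::
  "nat set \<Rightarrow> nat set \<Rightarrow> nat set \<Rightarrow> (nat \<Rightarrow> nat set) \<Rightarrow> (nat \<Rightarrow> nat \<times> nat) \<Rightarrow> nat \<times> nat" where
  "report N C X a b =
     (let m = edge_val N X a b (best N C X a b)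
      in (m, if uncovered C X b then m else Min ((\<lambda>w. snd (b w)) ` C)))"

text \<open>Ties are broken by choice, but the predicate of being a minimiser depends only on values
  at candidates. So the choice made from received data is the very vertex that the global definition
  names.\<close>

lemma best_cong:
  assumes "\<And>u. u \<in> N \<Longrightarrow> a u = a' u" "\<And>w. w \<in> C \<Longrightarrow> b w = b' w"
  shows "best N C X a b = best N C X a' b'"
proof -
  have "edge_val N X a b u = edge_val N X a' b' u" if "u \<in> N \<union> C" for u
    using that assms by (auto simp: edge_val_def)
  then have "is_arg_min (edge_val N X a b) (\<lambda>x. x \<in> N \<union> C)
      = is_arg_min (edge_val N X a' b') (\<lambda>x. x \<in> N \<union> C)"
    unfolding is_arg_min_def fun_eq_iff by metis
  then show ?thesis by (simp add: best_def arg_min_on_def arg_min_def)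
qed

lemma uncovered_cong:
  "(\<And>w. w \<in> C \<Longrightarrow> b w = b' w) \<Longrightarrow> uncovered C X b = uncovered C X b'"
  by (simp add: uncovered_def)

lemma best_in: "finite (N \<union> C) \<Longrightarrow> N \<union> C \<noteq> {} \<Longrightarrow> best N C X a b \<in> N \<union> C"
  unfolding best_def by (rule arg_min_if_finite)

lemma edge_val_best_le:
  "finite (N \<union> C) \<Longrightarrow> u \<in> N \<union> C \<Longrightarrow> edge_val N X a b (best N C X a b) \<le> edge_val N X a b u"
  unfolding best_def by (rule arg_min_least) auto

lemma report_cong:
  assumes "finite (N \<union> C)" "N \<union> C \<noteq> {}"
    and "\<And>u. u \<in> N \<Longrightarrow> a u = a' u" "\<And>w. w \<in> C \<Longrightarrow> b w = b' w"
  shows "report N C X a b = report N C X a' b'"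
proof -
  have "best N C X a b = best N C X a' b'" "uncovered C X b = uncovered C X b'"
    "(\<lambda>w. snd (b w)) ` C = (\<lambda>w. snd (b' w)) ` C"
    using assms by (auto intro!: best_cong uncovered_cong)
  moreover have "edge_val N X a b (best N C X a' b') = edge_val N X a' b' (best N C X a' b')"
    using best_in[OF assms(1,2), of X a' b'] assms by (auto simp: edge_val_def)
  ultimately show ?thesis unfolding report_def Let_def by (simp only:)
qed

context tap
begin

text \<open>The counter \<open>h - dep v\<close> bounds the height of the subtree of \<open>v\<close>.\<close>

primrec rep_aux :: "nat \<Rightarrow> nat \<Rightarrow> nat \<times> nat" where
  "rep_aux 0 v = report (cross v) (children v) (anc v) anc (\<lambda>_. (0, 0))"
| "rep_aux (Suc i) v = report (cross v) (children v) (anc v) anc (rep_aux i)"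

definition rep :: "nat \<Rightarrow> nat \<times> nat" where
  "rep v = rep_aux (h - dep v) v"

abbreviation low :: "nat \<Rightarrow> nat" where
  "low v \<equiv> fst (rep v)"

abbreviation cov :: "nat \<Rightarrow> nat" where
  "cov v \<equiv> snd (rep v)"

abbreviation val :: "nat \<Rightarrow> nat \<Rightarrow> nat" where
  "val x y \<equiv> card (anc x \<inter> anc y)"

definition bst :: "nat \<Rightarrow> nat" where
  "bst v = best (cross v) (children v) (anc v) anc rep"

abbreviation unc :: "nat \<Rightarrow> bool" where
  "unc v \<equiv> uncovered (children v) (anc v) rep"

text \<open>Below the root there is another vertex; below any other \<open>v\<close>,
  2-edge-connectivity gives a non-tree edge with an endpoint in the subtree. That endpoint is
  \<open>v\<close> itself or lies under a child.\<close>

lemma cands_nonempty: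
  assumes "v \<in> V" "V \<noteq> {r}"
  shows "cross v \<union> children v \<noteq> {}"
proof -
  have "\<exists>x. x \<in> V \<and> v \<in> anc x \<and> (x \<noteq> v \<or> cross x \<noteq> {})"
  proof (cases "v = r")
    case True
    then show ?thesis using assms root_in_anc by blast
  next
    case False
    then obtain x y where xy: "{x, y} \<in> E - T" "v \<in> anc x"
      using two_edge_connected_covered[OF graph_2ec tree_subset subset_refl assms(1) False]
      unfolding covered_def by blast
    then have "x \<in> V" "y \<in> cross x" using edge_D by (auto simp: cross_def insert_commute)
    then show ?thesis using xy by blast
  qed
  then obtain x where x: "x \<in> V" "v \<in> anc x" "x \<noteq> v \<or> cross x \<noteq> {}" by blast
  show ?thesis
  proof (cases "x = v")
    case False
    then show ?thesis using descend[OF x(1,2)] by auto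
  qed (use x in auto)
qed

lemma rep_eq:
  assumes "v \<in> V" "V \<noteq> {r}"
  shows "rep v = report (cross v) (children v) (anc v) anc rep"
proof (cases "h - dep v")
  case 0
  \<comment> \<open>At depth \<open>h\<close> there are no children, so the dummy reports
    \<open>(0, 0)\<close> are never read.\<close>
  then have "children v = {}"
    using children_D(1,5) dep_le_h by fastforce
  then show ?thesis
    using 0 cands_nonempty[OF assms] finite_cross
    by (auto simp: rep_def intro!: report_cong)
next
  case (Suc i)
  have "rep w = rep_aux i w" if "w \<in> children v" for w
  proof -
    have "h - dep w = i" using Suc children_D(5)[OF that] by simp
    then show ?thesis by (simp add: rep_def)
  qed
  then show ?thesis
    using Suc cands_nonempty[OF assms] finite_cross finite_children
    by (auto simp: rep_def[of v] intro!: report_cong)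
qed

lemma
  assumes "v \<in> V" "V \<noteq> {r}"
  shows bst_in: "bst v \<in> cross v \<union> children v"
    and low_eq: "low v = (if bst v \<in> cross v then val v (bst v) else low (bst v))"
    and low_le_cross: "u \<in> cross v \<Longrightarrow> low v \<le> val v u"
    and low_le_child: "w \<in> children v \<Longrightarrow> low v \<le> low w"
    and cov_uncovered: "unc v \<Longrightarrow> cov v = low v"
    and cov_covered: "\<not> unc v \<Longrightarrow> cov v = Min (cov ` children v)"
proof -
  have fin: "finite (cross v \<union> children v)" by (simp add: finite_cross finite_children)
  show "bst v \<in> cross v \<union> children v"
    unfolding bst_def using fin cands_nonempty[OF assms] by (rule best_in)
  show low: "low v = (if bst v \<in> cross v then val v (bst v) else low (bst v))"
    by (simp add: rep_eq[OF assms] report_def Let_def edge_val_def bst_def)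
  have "low v \<le> edge_val (cross v) (anc v) anc rep u" if "u \<in> cross v \<union> children v" for u
    using edge_val_best_le[OF fin that]
    by (simp add: rep_eq[OF assms] report_def Let_def)
  from this[of u] this[of w] children_not_cross[of w v]
  show "u \<in> cross v \<Longrightarrow> low v \<le> val v u" "w \<in> children v \<Longrightarrow> low v \<le> low w"
    by (auto simp: edge_val_def)
  show "unc v \<Longrightarrow> cov v = low v" "\<not> unc v \<Longrightarrow> cov v = Min (cov ` children v)"
    by (simp_all add: rep_eq[OF assms] report_def Let_def)
qed

lemma not_singleton: "v \<in> V \<Longrightarrow> v \<noteq> r \<Longrightarrow> V \<noteq> {r}"
  by auto

lemma low_mono:
  assumes "V \<noteq> {r}"
  shows "x \<in> V \<Longrightarrow> v \<in> anc x \<Longrightarrow> low v \<le> low x"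
proof (induction "dep x" arbitrary: x rule: less_induct)
  case less
  show ?case
  proof (cases "x = v")
    case False
    with less.prems have x: "x \<noteq> r" "v \<in> anc (par x)" using anc_parI by blast+
    then have "low v \<le> low (par x)"
      using less dep_par[of x] par_in_V[of x] by auto
    also have "\<dots> \<le> low x"
      using less.prems x par_in_V[of x] assms by (intro low_le_child) (auto simp: children_def)
    finally show ?thesis .
  qed simp
qed

lemma low_le_val:
  assumes "V \<noteq> {r}" "v \<in> anc x" "y \<in> cross x"
  shows "low v \<le> val x y"
proof -
  have x: "x \<in> V" using cross_D assms by blast
  have "low v \<le> low x" using assms x by (intro low_mono)
  also have "\<dots> \<le> val x y" using assms x by (intro low_le_cross)
  finally show ?thesis .
qed

text \<open>The minimum is taken over all non-tree edges with an endpoint below \<open>v\<close>.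
  Since one of them leaves the subtree, the minimum is small enough that an edge attaining it leaves
  too.\<close>

lemma low_less:
  assumes v: "v \<in> V" "v \<noteq> r"
  shows "low v < card (anc v)"
proof -
  obtain x y where xy: "{x, y} \<in> E - T" "v \<in> anc x" "v \<notin> anc y"
    using two_edge_connected_covered[OF graph_2ec tree_subset subset_refl v] by (auto simp: covered_def)
  then have "x \<in> V" "y \<in> V" "y \<in> cross x"
    using edge_D[of x y] by (auto simp: cross_def insert_commute)
  then have "low v \<le> val x y" using low_le_val[OF not_singleton[OF v]] xy by blast
  also have "\<dots> < card (anc v)"
    using common_anc_less_iff \<open>x \<in> V\<close> \<open>y \<in> V\<close> xy by blast
  finally show ?thesis .
qed

lemma cov_attained:
  assumes "v \<in> V" "V \<noteq> {r}" "\<not> unc v"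
  obtains w where "w \<in> children v" "cov w = cov v" "cov v < card (anc v)"
proof -
  obtain w where w: "w \<in> children v" "cov w < card (anc v)"
    using assms by (auto simp: uncovered_def not_le)
  have eq: "cov v = Min (cov ` children v)" using cov_covered assms by blast
  moreover have "Min (cov ` children v) \<in> cov ` children v"
    using w finite_children by (intro Min_in) auto
  moreover have "Min (cov ` children v) \<le> cov w"
    using w finite_children by (intro Min_le) auto
  ultimately show thesis using w that by auto
qed

lemma cov_less: "v \<in> V \<Longrightarrow> v \<noteq> r \<Longrightarrow> cov v < card (anc v)"
  using low_less cov_attained cov_uncovered not_singleton by metis

lemma cov_le_child:
  assumes "w \<in> children v" "cov w < card (anc v)"
  shows "cov v \<le> cov w"
proof -
  have v: "v \<in> V" "V \<noteq> {r}" using assms children_D by auto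
  have "\<not> unc v" using assms by (auto simp: uncovered_def not_le)
  then have "cov v = Min (cov ` children v)" using cov_covered v by blast
  also have "\<dots> \<le> cov w" using assms finite_children by auto
  finally show ?thesis .
qed

text \<open>Vertices between \<open>x\<close> and \<open>v\<close> have at least as many ancestors
  as \<open>v\<close>, so the value reported by \<open>x\<close> covers all their parent edges. None
  of them is uncovered, hence each takes a minimum over its children and the value can only decrease
  on the way up.\<close>

lemma cov_mono:
  "x \<in> V \<Longrightarrow> v \<in> anc x \<Longrightarrow> cov x < card (anc v) \<Longrightarrow> cov v \<le> cov x"
proof (induction "dep x" arbitrary: x rule: less_induct)
  case less
  show ?case
  proof (cases "x = v")
    case False
    with less.prems have x: "x \<noteq> r" "v \<in> anc (par x)" using anc_parI by blast+
    then have p: "par x \<in> V" "x \<in> children (par x)" "dep (par x) < dep x"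
      using less.prems par_in_V[of x] dep_par[of x] by (auto simp: children_def)
    have "anc v \<subseteq> anc (par x)" using anc_trans p x by auto
    then have "card (anc v) \<le> card (anc (par x))" by (intro card_mono) (auto simp: finite_anc)
    then have "cov (par x) \<le> cov x" using less.prems p by (intro cov_le_child) auto
    moreover from this have "cov v \<le> cov (par x)"
      using less p x by auto
    ultimately show ?thesis by simp
  qed simp
qed

text \<open>Supplies the contradiction behind the factor 2: the report reaches \<open>v\<close>
  through the child above \<open>x\<close>.\<close>

lemma covered_by_lower:
  assumes x: "x \<in> V" "v \<in> anc x" "v \<noteq> x" and less: "cov x < card (anc v)"
  shows "\<not> unc v"
proof -
  obtain w where w: "w \<in> children v" "w \<in> anc x" using descend[OF x] by blast
  have "card (anc v) \<le> card (anc w)" using w children_D(6)[OF w(1)] 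
    by (intro card_mono) (auto simp: finite_anc)
  then have "cov w \<le> cov x" using less x w by (intro cov_mono) auto
  then show ?thesis using w less by (auto simp: uncovered_def not_le intro: le_less_trans)
qed


section \<open>Routing picks to non-tree edges\<close>

primrec final_edge_aux :: "nat \<Rightarrow> nat \<Rightarrow> nat set" where
  "final_edge_aux 0 v = {v, bst v}"
| "final_edge_aux (Suc i) v = (if bst v \<in> children v then final_edge_aux i (bst v) else {v, bst v})"

text \<open>The edge at which a pick of \<open>v\<close> arrives when best candidates are followed
  down. The counter cannot run out early, as a vertex of depth \<open>h\<close> has no
  children.\<close>

definition final_edge :: "nat \<Rightarrow> nat set" where
  "final_edge v = final_edge_aux (h - dep v) v"

lemma final_edge_eq:
  "final_edge v = (if bst v \<in> children v then final_edge (bst v) else {v, bst v})"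
proof (cases "h - dep v")
  case 0
  then have "bst v \<notin> children v" using children_D(1,5) dep_le_h by fastforce
  then show ?thesis using 0 by (simp add: final_edge_def)
next
  case (Suc i)
  have "h - dep (bst v) = i" if "bst v \<in> children v"
    using Suc children_D(5)[OF that] by simp
  then show ?thesis using Suc by (simp add: final_edge_def)
qed

lemma bottom_up_induct [consumes 1, case_names step]:
  assumes "v \<in> V" "\<And>v. v \<in> V \<Longrightarrow> (\<And>w. w \<in> children v \<Longrightarrow> P w) \<Longrightarrow> P v"
  shows "P v"
  using assms(1)
proof (induction "h - dep v" arbitrary: v rule: less_induct)
  case less
  show ?case
  proof (rule assms(2)[OF less.prems])
    fix w assume w: "w \<in> children v"
    have "h - dep w < h - dep v"
      using children_D(5)[OF w] dep_le_h[OF children_D(1)[OF w]] by simp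
    then show "P w" using less.hyps children_D(1)[OF w] by simp
  qed
qed

lemma final_edge_val:
  assumes "v \<in> V" "V \<noteq> {r}"
  shows "\<exists>x y. final_edge v = {x, y} \<and> y \<in> cross x \<and> v \<in> anc x \<and> val x y = low v"
  using assms(1)
proof (induction rule: bottom_up_induct)
  case (step v)
  show ?case
  proof (cases "bst v \<in> children v")
    case True
    then obtain x y where xy: "final_edge (bst v) = {x, y}" "y \<in> cross x" "bst v \<in> anc x"
      "val x y = low (bst v)"
      using step by blast
    have "anc (bst v) \<subseteq> anc x" using anc_trans cross_D xy by blast
    then have "v \<in> anc x" using children_D(6)[OF True] anc_refl by auto
    then show ?thesis
      using xy True children_not_cross[OF True] low_eq[OF step.hyps assms(2)]
      by (auto simp: final_edge_eq[of v])
  next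
    case False
    then have "bst v \<in> cross v" using bst_in[OF step.hyps assms(2)] by blast
    then show ?thesis
      using False low_eq[OF step.hyps assms(2)] anc_refl
      by (auto simp: final_edge_eq[of v])
  qed
qed

text \<open>One boolean per vertex suffices for routing: picks that meet at a vertex continue along
  the same \<open>bst\<close> and end in the same edge.\<close>

inductive flagged :: "nat \<Rightarrow> bool" where
  flagged_start: "v \<in> V \<Longrightarrow> v \<noteq> r \<Longrightarrow> unc v \<Longrightarrow> flagged v"
| flagged_step: "flagged v \<Longrightarrow> bst v \<in> children v \<Longrightarrow> flagged (bst v)"

lemma flagged_in_V: "flagged v \<Longrightarrow> v \<in> V \<and> v \<noteq> r"
  by (induction rule: flagged.induct) (use children_D in auto)

lemma flagged_iff:
  assumes "v \<in> V" "v \<noteq> r"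
  shows "flagged v \<longleftrightarrow> unc v \<or> flagged (par v) \<and> bst (par v) = v"
proof
  assume "flagged v"
  then show "unc v \<or> flagged (par v) \<and> bst (par v) = v"
    by cases (use children_D(4) in auto)
next
  have "v \<in> children (par v)" using assms by (simp add: children_def)
  moreover assume "unc v \<or> flagged (par v) \<and> bst (par v) = v"
  ultimately show "flagged v"
    using assms flagged_start flagged_step[of "par v"] by auto
qed

definition greedy :: "nat set set" where
  "greedy = {{v, bst v} | v. flagged v \<and> bst v \<in> cross v}"

lemma final_edge_greedy:
  assumes "v \<in> V" "flagged v"
  shows "final_edge v \<in> greedy"
  using assms
proof (induction rule: bottom_up_induct)
  case (step v)
  show ?case
  proof (cases "bst v \<in> children v")
    case True
    then show ?thesis using step flagged_step final_edge_eq[of v] by auto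
  next
    case False
    then have "bst v \<in> cross v"
      using bst_in step not_singleton flagged_in_V by blast
    then show ?thesis using False step by (auto simp: greedy_def final_edge_eq[of v])
  qed
qed

text \<open>A flag is traced back to the picking vertex where it started; \<open>final_edge\<close>
  is constant along the way. This bounds the number of selected edges by the number of
  picks.\<close>

lemma greedy_final_edge:
  assumes "flagged v"
  shows "\<exists>a\<in>V - {r}. unc a \<and> final_edge a = final_edge v"
  using assms
proof (induction rule: flagged.induct)
  case (flagged_step v)
  then show ?case using final_edge_eq[of v] by simp
qed auto

text \<open>Backs the number \<open>cov v\<close> by an edge that is really selected: the child
  attaining the minimum is followed down to a picking vertex, whose pick is routed to its
  \<open>final_edge\<close>.\<close>

lemma greedy_edge_below:
  assumes "v \<in> V" "v \<noteq> r"
  shows "\<exists>x y. {x, y} \<in> greedy \<and> y \<in> cross x \<and> v \<in> anc x \<and> val x y \<le> cov v"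
  using assms
proof (induction rule: bottom_up_induct)
  case (step v)
  have V: "V \<noteq> {r}" using step not_singleton by blast
  show ?case
  proof (cases "unc v")
    case True
    then have "final_edge v \<in> greedy" using step by (intro final_edge_greedy flagged_start)
    then show ?thesis
      using final_edge_val[OF step.hyps V] cov_uncovered[OF step.hyps V True] by fastforce
  next
    case False
    then obtain w where w: "w \<in> children v" "cov w = cov v"
      using cov_attained[OF step.hyps V] by blast
    then obtain x y where xy: "{x, y} \<in> greedy" "y \<in> cross x" "w \<in> anc x" "val x y \<le> cov v"
      using step.IH[OF w(1)] children_D[OF w(1)] by metis
    have "anc w \<subseteq> anc x" using anc_trans cross_D xy by blast
    then have "v \<in> anc x" using children_D(6)[OF w(1)] anc_refl by auto
    with xy show ?thesis by blast
  qed
qed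

lemma greedy_augmentation: "augmentation V E T greedy"
  unfolding augmentation_iff
proof (intro conjI ballI)
  show "greedy \<subseteq> E" by (auto simp: greedy_def cross_def insert_commute)
next
  fix v assume v: "v \<in> V - {r}"
  obtain x y where xy: "{x, y} \<in> greedy" "y \<in> cross x" "v \<in> anc x" "val x y \<le> cov v"
    using greedy_edge_below v by blast
  have "val x y < card (anc v)" using xy cov_less[of v] v by auto
  then have "v \<notin> anc y" using xy common_anc_less_iff cross_D by blast
  then show "covered greedy v" using xy by (auto simp: covered_def cross_def insert_commute)
qed

text \<open>
  An edge covers at most one picked tree edge on either side of the lowest common ancestor of its
  endpoints: the lower of two picked ones would have chosen an edge that also covers the upper one.
\<close>

lemma card_uncovered_le:
  assumes aug: "augmentation V E T F"
  shows "card {v \<in> V - {r}. unc v} \<le> 2 * card F"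
proof -
  let ?P = "{v \<in> V - {r}. unc v}" and ?O = "{(x, y). {x, y} \<in> F}"
  have F: "F \<subseteq> E" "\<And>v. v \<in> V - {r} \<Longrightarrow> covered F v"
    using aug augmentation_iff by auto
  then have fin: "finite F" using finite_E finite_subset by blast
  \<comment> \<open>The chosen edge is oriented, its first endpoint lying below \<open>v\<close>.
    The orientation records the side of the lowest common ancestor, so injectivity of
    \<open>p\<close> gives two picks per edge.\<close>
  define p where "p v = (SOME (x, y). {x, y} \<in> F - T \<and> v \<in> anc x \<and> v \<notin> anc y)" for v
  have p: "\<exists>x y. p v = (x, y) \<and> {x, y} \<in> F \<and> x \<in> V \<and> y \<in> V \<and> y \<in> cross x \<and> v \<in> anc x \<and> v \<notin> anc y"
    if "v \<in> ?P" for v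
  proof -
    have "\<exists>q. (\<lambda>(x, y). {x, y} \<in> F - T \<and> v \<in> anc x \<and> v \<notin> anc y) q"
      using F(2)[of v] that by (auto simp: covered_def)
    then have "(\<lambda>(x, y). {x, y} \<in> F - T \<and> v \<in> anc x \<and> v \<notin> anc y) (p v)"
      unfolding p_def by (rule someI_ex)
    then show ?thesis using F(1) edge_D
      by (cases "p v") (auto simp: cross_def insert_commute subset_iff)
  qed
  have upper: "v = v'" if P: "v \<in> ?P" "v' \<in> ?P" and eq: "p v = p v'" and anc: "v \<in> anc v'" for v v'
  proof (rule ccontr)
    assume neq: "v \<noteq> v'"
    obtain x y where xy: "{x, y} \<in> F" "x \<in> V" "y \<in> V" "y \<in> cross x" "v \<in> anc x" "v \<notin> anc y"
      "v' \<in> anc x"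
      using p[OF P(1)] p[OF P(2)] eq by auto
    have V: "V \<noteq> {r}" "v' \<in> V" "unc v'" using P by auto
    \<comment> \<open>The lower vertex \<open>v'\<close> picked an edge reaching at least as high as
      \<open>{x, y}\<close>, which covers \<open>v\<close>; so \<open>v\<close> was covered before
      its turn.\<close>
    have "cov v' = low v'" using cov_uncovered V by blast
    also have "\<dots> \<le> val x y" using low_le_val V xy by blast
    also have "\<dots> < card (anc v)" using common_anc_less_iff xy by blast
    finally have "\<not> unc v" using covered_by_lower V anc neq by blast
    then show False using P by simp
  qed
  have inj: "inj_on p ?P"
  proof (rule inj_onI)
    fix v v' assume P: "v \<in> ?P" "v' \<in> ?P" "p v = p v'"
    then obtain x where "x \<in> V" "v \<in> anc x" "v' \<in> anc x" using p[of v] p[of v'] by auto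
    then have "v \<in> anc v' \<or> v' \<in> anc v" by (rule anc_chain)
    then show "v = v'"
      using upper[OF P] upper[OF P(2,1) P(3)[symmetric]] by blast
  qed
  have range: "p ` ?P \<subseteq> ?O" using p by fastforce
  have O: "?O = (\<Union>e\<in>F. {(x, y). {x, y} = e})" by auto
  have two: "finite {(x, y). {x, y} = e} \<and> card {(x, y). {x, y} = e} = 2" if e: "e \<in> F" for e
  proof -
    obtain a b where ab: "e = {a, b}" "a \<noteq> b" using edge_card F e by (meson card_2_iff subsetD)
    then have "{(x, y). {x, y} = e} = {(a, b), (b, a)}" by (auto simp: doubleton_eq_iff)
    then show ?thesis using ab by simp
  qed
  have "finite ?O" unfolding O by (rule finite_UN_I[OF fin conjunct1[OF two]])
  then have "card ?P \<le> card ?O" by (rule card_inj_on_le[OF inj range])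
  also have "\<dots> \<le> (\<Sum>e\<in>F. card {(x, y). {x, y} = e})" unfolding O using fin by (rule card_UN_le)
  also have "\<dots> = 2 * card F" using two by simp
  finally show ?thesis .
qed

lemma greedy_approximation: "tap_approximation 2 V E T greedy"
proof -
  have "\<exists>F. augmentation V E T F \<and> card F = tap_opt V E T"
    unfolding tap_opt_def by (rule LeastI_ex) (use greedy_augmentation in blast)
  then obtain F where F: "augmentation V E T F" "card F = tap_opt V E T" by blast
  let ?P = "{v \<in> V - {r}. unc v}"
  have "greedy \<subseteq> final_edge ` ?P"
  proof
    fix e assume "e \<in> greedy"
    then obtain v where v: "e = {v, bst v}" "flagged v" "bst v \<in> cross v"
      by (auto simp: greedy_def)
    then have "e = final_edge v" using children_not_cross by (auto simp: final_edge_eq[of v])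
    then show "e \<in> final_edge ` ?P" using greedy_final_edge[OF v(2)] by auto
  qed
  then have "card greedy \<le> card ?P"
    using finite_V by (intro surj_card_le) auto
  also have "\<dots> \<le> 2 * tap_opt V E T" using card_uncovered_le[OF F(1)] F(2) by simp
  finally have "real (card greedy) \<le> 2 * real (tap_opt V E T)" by linarith
  then show ?thesis using greedy_augmentation by (simp add: tap_approximation_def)
qed

end

section \<open>The distributed algorithm\<close>

text \<open>
  A message has three components. The first one streams the ancestors of the sender, from the
  sender itself up to the root, one in each round, and is \<open>None\<close> afterwards. The second one is the
  report of the sender, once it is known. The third one is \<open>Some (Some u)\<close> or \<open>Some None\<close>
  once it is known whether the sender must realise its best candidate \<open>u\<close>.
\<close>

type_synonym msg = "nat option \<times> (nat \<times> nat) option \<times> nat option option"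

definition latest :: "msg list \<Rightarrow> msg" where
  "latest l = (case l of [] \<Rightarrow> (None, None, None) | m # _ \<Rightarrow> m)"

definition reported :: "msg list \<Rightarrow> (nat \<times> nat) option" where
  "reported l = fst (snd (latest l))"

definition decision :: "msg list \<Rightarrow> nat option option" where
  "decision l = snd (snd (latest l))"

lemma reported_Nil [simp]: "reported [] = None" and decision_Nil [simp]: "decision [] = None"
  by (simp_all add: reported_def decision_def latest_def)

definition ids :: "msg list \<Rightarrow> nat set" where
  "ids l = {x. Some x \<in> fst ` set l}"

text \<open>The first \<open>None\<close> follows the root's identifier and serves as the end marker
  for receivers that do not know the depth.\<close>

definition stream_complete :: "msg list \<Rightarrow> bool" where
  "stream_complete l \<longleftrightarrow> None \<in> fst ` set l"

definition loc_cross :: "tap_input \<Rightarrow> nat set" where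
  "loc_cross i = neighbours i - tree_neighbours i"

definition loc_children :: "tap_input \<Rightarrow> nat set" where
  "loc_children i = tree_neighbours i - set_option (parent i)"

definition loc_anc :: "tap_input \<Rightarrow> (nat \<Rightarrow> msg list) \<Rightarrow> nat set" where
  "loc_anc i R = insert (own_id i) (\<Union>p\<in>set_option (parent i). ids (R p))"

definition loc_report :: "tap_input \<Rightarrow> (nat \<Rightarrow> msg list) \<Rightarrow> nat \<times> nat" where
  "loc_report i R = report (loc_cross i) (loc_children i) (loc_anc i R)
     (\<lambda>u. ids (R u)) (\<lambda>w. the (reported (R w)))"

definition loc_best :: "tap_input \<Rightarrow> (nat \<Rightarrow> msg list) \<Rightarrow> nat" where
  "loc_best i R = best (loc_cross i) (loc_children i) (loc_anc i R)
     (\<lambda>u. ids (R u)) (\<lambda>w. the (reported (R w)))"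

text \<open>The quantifier over the parent is false at the root, which has no edge to cover and must
  never be flagged.\<close>

definition loc_flag :: "tap_input \<Rightarrow> (nat \<Rightarrow> msg list) \<Rightarrow> bool" where
  "loc_flag i R \<longleftrightarrow> (\<exists>p\<in>set_option (parent i).
     uncovered (loc_children i) (loc_anc i R) (\<lambda>w. the (reported (R w))) \<or>
     decision (R p) = Some (Some (own_id i)))"

definition report_ready :: "tap_input \<Rightarrow> (nat \<Rightarrow> msg list) \<Rightarrow> bool" where
  "report_ready i R \<longleftrightarrow> (\<forall>p\<in>set_option (parent i). stream_complete (R p)) \<and>
     (\<forall>u\<in>loc_cross i. stream_complete (R u)) \<and> (\<forall>w\<in>loc_children i. reported (R w) \<noteq> None)"

definition decision_ready :: "tap_input \<Rightarrow> (nat \<Rightarrow> msg list) \<Rightarrow> bool" where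
  "decision_ready i R \<longleftrightarrow> report_ready i R \<and>
     (\<forall>p\<in>set_option (parent i). decision (R p) \<noteq> None)"

text \<open>Empty inboxes reveal the first round, so no round counter is needed. Later a vertex
  repeats what its parent sent in the round before.\<close>

definition tap_message :: "tap_input \<Rightarrow> (nat \<Rightarrow> msg list) \<Rightarrow> msg" where
  "tap_message i R =
     (if \<forall>u\<in>neighbours i. R u = [] then Some (own_id i)
      else case parent i of None \<Rightarrow> None | Some p \<Rightarrow> fst (latest (R p)),
      if report_ready i R then Some (loc_report i R) else None,
      if decision_ready i R then Some (if loc_flag i R then Some (loc_best i R) else None) else None)"

text \<open>A non-tree edge may be selected by either endpoint, so the output has to wait for the
  decisions of all non-tree neighbours.\<close>

definition tap_result :: "tap_input \<Rightarrow> (nat \<Rightarrow> msg list) \<Rightarrow> nat set option" where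
  "tap_result i R =
     (if decision_ready i R \<and> (\<forall>u\<in>loc_cross i. decision (R u) \<noteq> None)
      then Some {u \<in> loc_cross i.
             loc_flag i R \<and> loc_best i R = u \<or> decision (R u) = Some (Some (own_id i))}
      else None)"

section \<open>Execution on a fixed instance: ancestor streams\<close>

context tap
begin

abbreviation inp :: "nat \<Rightarrow> tap_input" where
  "inp \<equiv> tap_local_input E T r"

abbreviation log_of :: "nat \<Rightarrow> nat \<Rightarrow> msg list" where
  "log_of t v \<equiv> sent tap_message E inp t v"

abbreviation box :: "nat \<Rightarrow> nat \<Rightarrow> nat \<Rightarrow> msg list" where
  "box t v \<equiv> inbox tap_message E inp t v"

definition message :: "nat \<Rightarrow> nat \<Rightarrow> msg" where
  "message t v = tap_message (inp v) (box t v)"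

lemma inp_simps:
  "own_id (inp v) = v" "neighbours (inp v) = {u. {u, v} \<in> E}"
  "tree_neighbours (inp v) = {u. {u, v} \<in> T}" "parent (inp v) = parent_of T r v"
  by (simp_all add: tap_local_input_def)

lemma loc_cross_inp: "loc_cross (inp v) = cross v"
  by (auto simp: loc_cross_def inp_simps cross_def)

lemma loc_children_inp: "v \<in> V \<Longrightarrow> loc_children (inp v) = children v"
  by (simp add: loc_children_def inp_simps children_eq)

lemma parent_inp: "v \<in> V \<Longrightarrow> set_option (parent (inp v)) = (if v = r then {} else {par v})"
  using parent_of_eq[of v] by (simp add: inp_simps parent_of_root)

lemma log_of_Suc: "log_of (Suc t) v = message t v # log_of t v"
  by (simp only: sent_Suc message_def)

lemma set_log_of: "set (log_of t v) = (\<lambda>i. message i v) ` {..<t}"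
  by (induction t) (simp_all add: log_of_Suc lessThan_Suc)

lemma box_eq: "{u, v} \<in> E \<Longrightarrow> box t v u = log_of t u"
  by (simp add: inbox_def)

lemma box_cross: "u \<in> cross v \<Longrightarrow> box t v u = log_of t u"
  by (rule box_eq) (simp add: cross_def)

lemma box_children: "w \<in> children v \<Longrightarrow> box t v w = log_of t w"
  using tree_subset by (intro box_eq) (auto dest: children_D(7))

lemma box_par: "v \<in> V \<Longrightarrow> v \<noteq> r \<Longrightarrow> box t v (par v) = log_of t (par v)"
  using tree_subset par_edge by (intro box_eq) auto

lemma latest_log_of:
  "latest (log_of t v) = (case t of 0 \<Rightarrow> (None, None, None) | Suc s \<Rightarrow> message s v)"
  by (cases t) (simp_all add: latest_def log_of_Suc)

text \<open>Pipelining: the \<open>t\<close>-th ancestor of the parent is the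
  \<open>Suc t\<close>-th ancestor of \<open>v\<close>. A vertex other than a lone root has a
  neighbour, so its inbox is nonempty after round 0.\<close>

lemma fst_message:
  assumes V: "V \<noteq> {r}" and v: "v \<in> V"
  shows "fst (message t v) = (if t \<le> dep v then Some ((par ^^ t) v) else None)"
  using v
proof (induction t arbitrary: v)
  case 0
  then show ?case by (simp add: message_def tap_message_def inbox_def inp_simps)
next
  case (Suc t)
  obtain u where "u \<in> cross v \<union> children v" using cands_nonempty[OF Suc.prems V] by blast
  then have u: "{u, v} \<in> E"
    using tree_subset children_D(7) by (auto simp: cross_def)
  then have nonempty: "\<not> (\<forall>u\<in>neighbours (inp v). box (Suc t) v u = [])"
    using box_eq[OF u, of "Suc t"] by (auto simp: inp_simps sent_Suc)
  show ?case
  proof (cases "v = r")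
    case True
    then show ?thesis using nonempty
      by (auto simp: message_def tap_message_def inp_simps parent_of_root)
  next
    case False
    then have "fst (message (Suc t) v) = fst (message t (par v))"
      using nonempty Suc.prems parent_of_eq[of v]
      by (auto simp: message_def[of "Suc t"] tap_message_def inp_simps box_par latest_log_of)
    then show ?thesis
      using Suc.IH[OF par_in_V] Suc.prems False dep_par[of v]
      by (simp add: funpow_Suc_right del: funpow.simps(2))
  qed
qed

text \<open>Messages 0 to \<open>dep v\<close> carry identifiers and message
  \<open>Suc (dep v)\<close> is the first \<open>None\<close>; the log after \<open>t\<close> rounds
  holds messages 0 to \<open>t - 1\<close>.\<close>

lemma stream_complete_log_of:
  assumes "V \<noteq> {r}" "v \<in> V"
  shows "stream_complete (log_of t v) \<longleftrightarrow> Suc (dep v) < t"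
proof -
  have "stream_complete (log_of t v) \<longleftrightarrow> (\<exists>i<t. fst (message i v) = None)"
    unfolding stream_complete_def set_log_of by force
  also have "\<dots> \<longleftrightarrow> (\<exists>i<t. dep v < i)"
    by (intro ex_cong) (simp add: fst_message[OF assms] not_le)
  also have "\<dots> \<longleftrightarrow> Suc (dep v) < t" by (auto intro: le_less_trans Suc_leI)
  finally show ?thesis .
qed

lemma ids_log_of:
  assumes "V \<noteq> {r}" "v \<in> V" "Suc (dep v) < t"
  shows "ids (log_of t v) = anc v"
proof -
  have "ids (log_of t v) = {x. \<exists>i<t. fst (message i v) = Some x}"
    unfolding ids_def set_log_of by force
  also have "\<dots> = anc v"
    using assms(3) by (auto simp: fst_message[OF assms(1,2)] anc_def)
  finally show ?thesis .
qed

section \<open>Convergecast of reports and broadcast of decisions\<close>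

abbreviation rd :: "nat \<Rightarrow> nat \<Rightarrow> bool" where
  "rd t v \<equiv> report_ready (inp v) (box t v)"

abbreviation dc :: "nat \<Rightarrow> nat \<Rightarrow> bool" where
  "dc t v \<equiv> decision_ready (inp v) (box t v)"

lemma reported_log_of:
  "reported (log_of t v) =
     (case t of 0 \<Rightarrow> None | Suc s \<Rightarrow> if rd s v then Some (loc_report (inp v) (box s v)) else None)"
  by (simp add: reported_def latest_log_of message_def tap_message_def split: nat.split)

lemma decision_log_of:
  "decision (log_of t v) =
     (case t of 0 \<Rightarrow> None | Suc s \<Rightarrow>
        if dc s v then Some (if loc_flag (inp v) (box s v) then Some (loc_best (inp v) (box s v)) else None)
        else None)"
  by (simp add: decision_def latest_log_of message_def tap_message_def split: nat.split)

lemma rd_iff: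
  assumes "V \<noteq> {r}" "v \<in> V"
  shows "rd t v \<longleftrightarrow> (v \<noteq> r \<longrightarrow> Suc (dep (par v)) < t) \<and> (\<forall>u\<in>cross v. Suc (dep u) < t) \<and>
    (\<forall>w\<in>children v. \<exists>s. t = Suc s \<and> rd s w)"
proof -
  have "(\<forall>p\<in>set_option (parent (inp v)). stream_complete (box t v p)) \<longleftrightarrow> (v \<noteq> r \<longrightarrow> Suc (dep (par v)) < t)"
    using assms par_in_V[of v] by (simp add: parent_inp box_par stream_complete_log_of)
  moreover have "(\<forall>u\<in>loc_cross (inp v). stream_complete (box t v u)) \<longleftrightarrow> (\<forall>u\<in>cross v. Suc (dep u) < t)"
    using assms cross_D by (simp add: loc_cross_inp box_cross stream_complete_log_of)
  moreover have "(\<forall>w\<in>loc_children (inp v). reported (box t v w) \<noteq> None) \<longleftrightarrow>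
      (\<forall>w\<in>children v. \<exists>s. t = Suc s \<and> rd s w)"
    using assms by (cases t) (auto simp: loc_children_inp box_children reported_log_of)
  ultimately show ?thesis by (simp add: report_ready_def)
qed

lemma rd_Suc:
  assumes V: "V \<noteq> {r}" and v: "v \<in> V"
  shows "rd t v \<Longrightarrow> rd (Suc t) v"
  using v
proof (induction arbitrary: t rule: bottom_up_induct)
  case (step v)
  then show ?case unfolding rd_iff[OF V step.hyps] by (auto simp: less_SucI)
qed

text \<open>All streams are complete at time \<open>h + 2\<close>, when vertices of depth
  \<open>h\<close> are ready; each level upwards costs one round. The sum avoids natural
  subtraction.\<close>

lemma rd_eventually:
  assumes V: "V \<noteq> {r}" and v: "v \<in> V"
  shows "2 * h + 2 \<le> t + dep v \<Longrightarrow> rd t v"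
  using v
proof (induction arbitrary: t rule: bottom_up_induct)
  case (step v)
  have t: "h + 2 \<le> t" using step.prems dep_le_h[OF step.hyps] by simp
  then obtain s where s: "t = Suc s" by (cases t) auto
  have "Suc (dep u) < t" if "u \<in> V" for u using dep_le_h[OF that] t by simp
  moreover have "rd s w" if "w \<in> children v" for w
    using step.IH[OF that] step.prems children_D(5)[OF that] s by simp
  ultimately show ?case
    using rd_iff[OF V step.hyps] par_in_V step.hyps cross_D s by auto
qed

text \<open>Readiness guarantees complete streams and reports of ready children, which are correct
  by induction from the leaves. The round number does not matter.\<close>

lemma rd_correct:
  assumes V: "V \<noteq> {r}" and v: "v \<in> V"
  shows "rd t v \<Longrightarrow> loc_report (inp v) (box t v) = rep v \<and> loc_best (inp v) (box t v) = bst v \<and>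
    uncovered (loc_children (inp v)) (loc_anc (inp v) (box t v)) (\<lambda>w. the (reported (box t v w))) = unc v"
  using v
proof (induction arbitrary: t rule: bottom_up_induct)
  case (step v)
  note rd = step.prems[unfolded rd_iff[OF V step.hyps]]
  have anc: "loc_anc (inp v) (box t v) = anc v"
  proof (cases "v = r")
    case True
    then show ?thesis using step.hyps by (simp add: loc_anc_def parent_inp inp_simps(1))
  next
    case False
    then show ?thesis
      using step.hyps rd par_in_V[of v] V anc_unfold[of v]
      by (simp add: loc_anc_def parent_inp inp_simps(1) box_par ids_log_of)
  qed
  have ids: "ids (box t v u) = anc u" if "u \<in> cross v" for u
    using that rd V cross_D[OF that] by (simp add: box_cross ids_log_of)
  have rep: "the (reported (box t v w)) = rep w" if w: "w \<in> children v" for w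
  proof -
    obtain s where "t = Suc s" "rd s w" using rd w by blast
    then show ?thesis using step.IH[OF w] w by (simp add: box_children reported_log_of)
  qed
  have fin: "finite (cross v \<union> children v)" by (simp add: finite_cross finite_children)
  have "loc_report (inp v) (box t v) = report (cross v) (children v) (anc v) anc rep"
    unfolding loc_report_def loc_cross_inp loc_children_inp[OF step.hyps] anc
    using ids rep cands_nonempty[OF step.hyps V] fin by (intro report_cong)
  moreover have "loc_best (inp v) (box t v) = bst v"
    unfolding loc_best_def loc_cross_inp loc_children_inp[OF step.hyps] anc bst_def
    using ids rep by (intro best_cong)
  moreover have "uncovered (children v) (anc v) (\<lambda>w. the (reported (box t v w))) = unc v"
    using rep by (rule uncovered_cong)
  ultimately show ?case
    using rep_eq[OF step.hyps V] anc loc_children_inp[OF step.hyps] by simp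
qed

lemma dc_iff:
  assumes "v \<in> V"
  shows "dc t v \<longleftrightarrow> rd t v \<and> (v \<noteq> r \<longrightarrow> (\<exists>s. t = Suc s \<and> dc s (par v)))"
proof -
  have "decision (log_of t u) \<noteq> None \<longleftrightarrow> (\<exists>s. t = Suc s \<and> dc s u)" for u
    by (cases t) (simp_all add: decision_log_of)
  then show ?thesis
    using assms by (simp add: decision_ready_def[of "inp v"] parent_inp box_par)
qed

lemma top_down_induct [consumes 1, case_names step]:
  assumes "v \<in> V" "\<And>v. v \<in> V \<Longrightarrow> (v \<noteq> r \<Longrightarrow> P (par v)) \<Longrightarrow> P v"
  shows "P v"
  using assms(1)
proof (induction "dep v" arbitrary: v rule: less_induct)
  case less
  show ?case
  proof (rule assms(2)[OF less.prems])
    assume "v \<noteq> r"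
    then have "dep (par v) < dep v" "par v \<in> V"
      using less.prems dep_par[of v] par_in_V[of v] by auto
    then show "P (par v)" by (rule less.hyps)
  qed
qed

lemma dc_Suc:
  assumes V: "V \<noteq> {r}" and v: "v \<in> V"
  shows "dc t v \<Longrightarrow> dc (Suc t) v"
  using v
proof (induction arbitrary: t rule: top_down_induct)
  case (step v)
  then show ?case
    unfolding dc_iff[OF step.hyps] using rd_Suc[OF V step.hyps] by auto
qed

text \<open>The root is ready by round \<open>2 * h + 2\<close>, and its decision descends one level
  per round.\<close>

lemma dc_eventually:
  assumes V: "V \<noteq> {r}" and v: "v \<in> V"
  shows "2 * h + 2 + dep v \<le> t \<Longrightarrow> dc t v"
  using v
proof (induction arbitrary: t rule: top_down_induct)
  case (step v)
  obtain s where s: "t = Suc s" using step.prems by (cases t) auto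
  have "rd t v" using step by (intro rd_eventually[OF V]) auto
  moreover have "dc s (par v)" if "v \<noteq> r"
    using step.IH[OF that] step.prems dep_par[OF step.hyps that] s by simp
  ultimately show ?case unfolding dc_iff[OF step.hyps] using s by blast
qed

lemma dc_correct:
  assumes V: "V \<noteq> {r}" and v: "v \<in> V"
  shows "dc t v \<Longrightarrow> loc_flag (inp v) (box t v) = flagged v \<and> loc_best (inp v) (box t v) = bst v"
  using v
proof (induction arbitrary: t rule: top_down_induct)
  case (step v)
  have rd: "rd t v" using step.prems step.hyps dc_iff by blast
  show ?case
  proof (cases "v = r")
    case True
    then have "\<not> flagged v" using flagged_in_V by blast
    then show ?thesis
      using True step.hyps rd_correct[OF V step.hyps rd] by (simp add: loc_flag_def parent_inp)
  next
    case False
    then obtain s where s: "t = Suc s" "dc s (par v)"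
      using step.prems step.hyps dc_iff by blast
    have "decision (box t v (par v)) = Some (if flagged (par v) then Some (bst (par v)) else None)"
      using s step.IH[OF False s(2)] step.hyps False
      by (simp add: box_par decision_log_of)
    then show ?thesis
      using False rd_correct[OF V step.hyps rd] flagged_iff[OF step.hyps False] step.hyps
      by (auto simp: loc_flag_def parent_inp inp_simps(1))
  qed
qed

section \<open>Termination and output\<close>

definition finished :: "nat \<Rightarrow> nat \<Rightarrow> bool" where
  "finished t v \<longleftrightarrow> dc t v \<and> (\<forall>u\<in>cross v. \<exists>s. t = Suc s \<and> dc s u)"

lemma result_box:
  assumes V: "V \<noteq> {r}" and v: "v \<in> V"
  shows "tap_result (inp v) (box t v) = (if finished t v then Some (incident_part greedy v) else None)"
proof -
  have dec: "decision (box t v u) \<noteq> None \<longleftrightarrow> (\<exists>s. t = Suc s \<and> dc s u)" if "u \<in> cross v" for u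
    using that by (cases t) (auto simp: box_cross decision_log_of)
  then have finished: "finished t v \<longleftrightarrow> dc t v \<and> (\<forall>u\<in>cross v. decision (box t v u) \<noteq> None)"
    by (simp add: finished_def)
  show ?thesis
  proof (cases "finished t v")
    case True
    have own: "loc_flag (inp v) (box t v) = flagged v" "loc_best (inp v) (box t v) = bst v"
      using dc_correct[OF V v] True by (auto simp: finished_def)
    have other: "decision (box t v u) = Some (Some v) \<longleftrightarrow> flagged u \<and> bst u = v"
      if u: "u \<in> cross v" for u
    proof -
      obtain s where "t = Suc s" "dc s u" using True u by (auto simp: finished_def)
      then show ?thesis
        using dc_correct[OF V, of u s] cross_D[OF u] u
        by (auto simp: box_cross decision_log_of)
    qed
    have "{u \<in> cross v. flagged v \<and> bst v = u \<or> decision (box t v u) = Some (Some v)}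
        = incident_part greedy v"
      using other cross_commute
      by (auto simp: incident_part_def greedy_def doubleton_eq_iff)
    then show ?thesis
      using True finished own by (simp add: tap_result_def loc_cross_inp inp_simps(1))
  next
    case False
    then show ?thesis using finished by (auto simp: tap_result_def loc_cross_inp)
  qed
qed

lemma finished_mono:
  assumes V: "V \<noteq> {r}" and v: "v \<in> V" and "finished t v" "t \<le> t'"
  shows "finished t' v"
  using assms(4,3)
proof (induction rule: dec_induct)
  case (step t)
  then show ?case
    unfolding finished_def using dc_Suc[OF V] v cross_D by fastforce
qed

text \<open>Every decision is made by round \<open>3 * h + 2\<close>; one further round carries it
  across the non-tree edges.\<close>

lemma finished_eventually:
  assumes V: "V \<noteq> {r}" and v: "v \<in> V"
  shows "finished (3 * h + 3) v"
proof -
  have "dc t u" if "u \<in> V" "3 * h + 2 \<le> t" for t u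
    using that dep_le_h[of u] by (intro dc_eventually[OF V]) auto
  then show ?thesis using v cross_D by (auto simp: finished_def)
qed

lemma results_within:
  assumes v: "v \<in> V"
  shows "\<exists>s\<le>6 * h. (\<forall>t<s. tap_result (inp v) (box t v) = None) \<and>
    (\<forall>t\<ge>s. tap_result (inp v) (box t v) = Some (incident_part greedy v))"
proof (cases "V = {r}")
  \<comment> \<open>Here \<open>h = 0\<close>, so the output must be present in round 0; all the
    conditions of \<open>tap_result\<close> hold vacuously.\<close>
  case True
  then have "v = r" using v by simp
  have cross: "cross u = {}" for u
    using cross_D True by blast
  then have "greedy = {}" by (simp add: greedy_def)
  moreover have "loc_children (inp v) = {}"
    unfolding loc_children_inp[OF v] using True children_D(1,2) by blast
  ultimately have "tap_result (inp v) R = Some (incident_part greedy v)" for R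
    using \<open>v = r\<close> v cross
    by (simp add: tap_result_def decision_ready_def report_ready_def loc_cross_inp parent_inp
        incident_part_def)
  then show ?thesis by auto
next
  case False
  then obtain x where x: "x \<in> V" "x \<noteq> r" using root_in_V by blast
  then have "1 \<le> h" using dep_le_h[of x] dep_eq_0[of x] by linarith
  \<comment> \<open>The first finished round; as \<open>finished\<close> persists and the output no
    longer depends on \<open>t\<close>, the output is irrevocable.\<close>
  define s where "s = (LEAST t. finished t v)"
  have "finished s v"
    unfolding s_def by (rule LeastI[of "\<lambda>t. finished t v", OF finished_eventually[OF False v]])
  show ?thesis
  proof (intro exI[of _ s] conjI allI impI)
    have "s \<le> 3 * h + 3"
      unfolding s_def by (rule Least_le) (rule finished_eventually[OF False v])
    with \<open>1 \<le> h\<close> show "s \<le> 6 * h" by simp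
  next
    fix t assume "t < s"
    then have "\<not> finished t v" unfolding s_def by (rule not_less_Least)
    then show "tap_result (inp v) (box t v) = None" by (simp add: result_box[OF False v])
  next
    fix t assume "s \<le> t"
    then have "finished t v" by (rule finished_mono[OF False v \<open>finished s v\<close>])
    then show "tap_result (inp v) (box t v) = Some (incident_part greedy v)"
      by (simp add: result_box[OF False v])
  qed
qed

section \<open>Size of messages\<close>

lemma val_le: "x \<in> V \<Longrightarrow> val x y \<le> card V"
  using anc_D finite_V by (intro card_mono) auto

lemma rep_le:
  assumes "V \<noteq> {r}" "v \<in> V"
  shows "low v \<le> card V" "cov v \<le> card V"
proof -
  obtain x y where "y \<in> cross x" "val x y = low v" using final_edge_val assms by blast
  then show low: "low v \<le> card V" using val_le cross_D by metis
  have "card (anc v) \<le> card V" using anc_D finite_V assms by (intro card_mono) auto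
  then show "cov v \<le> card V"
    using low cov_uncovered cov_attained assms by (metis less_imp_le_nat order_trans)
qed

lemma message_cases:
  assumes V: "V \<noteq> {r}" and v: "v \<in> V"
  obtains a b c where "message t v = (a, b, c)" "set_option a \<subseteq> V"
    "b = None \<or> b = Some (rep v)" "c = None \<or> c = Some None \<or> c = Some (Some (bst v))"
proof -
  obtain a b c where m: "message t v = (a, b, c)" by (cases "message t v") auto
  have a: "set_option a \<subseteq> V"
    using fst_message[OF V v, of t] dep_par_power[OF v, of t] m by auto
  have b: "b = None \<or> b = Some (rep v)"
    using m rd_correct[OF V v] by (auto simp: message_def tap_message_def split: if_splits)
  have c: "c = None \<or> c = Some None \<or> c = Some (Some (bst v))"
    using m dc_correct[OF V v] by (auto simp: message_def tap_message_def split: if_splits)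
  from m a b c show thesis by (rule that)
qed

end

definition option_code :: "nat option \<Rightarrow> nat" where
  "option_code a = (case a of None \<Rightarrow> 0 | Some x \<Rightarrow> Suc x)"

definition message_code :: "msg \<Rightarrow> bool list" where
  "message_code = (\<lambda>(a, b, c). bits (prod_encode (option_code a,
     prod_encode (option_code (map_option prod_encode b), option_code (map_option option_code c)))))"

lemma inj_option_code: "inj option_code"
  by (auto simp: inj_def option_code_def split: option.splits)

lemma inj_message_code: "inj message_code"
proof (rule injI)
  fix m m' assume "message_code m = message_code m'"
  moreover obtain a b c a' b' c' where "m = (a, b, c)" "m' = (a', b', c')" by (metis prod.exhaust)
  ultimately show "m = m'"
    by (auto simp: message_code_def inj_eq[OF inj_bits] inj_eq[OF inj_option_code]
        inj_eq[OF option.inj_map[OF inj_option_code]]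
        inj_eq[OF option.inj_map[OF inj_prod_encode]])
qed

text \<open>An option costs one \<open>Suc\<close>, hence at most one factor \<open>n\<close>.
  Identifiers are below \<open>n ^ k\<close> and a report is at most \<open>n ^ 6\<close>, so
  \<open>n ^ (k + 7)\<close> bounds every component. Two nested pairings multiply the exponent by
  36, and \<open>length_bits_le\<close> adds one.\<close>

lemma length_message_code_le:
  assumes n: "2 \<le> n" and a: "\<And>x. a = Some x \<Longrightarrow> x < n ^ k"
    and b: "\<And>x y. b = Some (x, y) \<Longrightarrow> x \<le> n \<and> y \<le> n"
    and c: "\<And>x. c = Some (Some x) \<Longrightarrow> x < n ^ k"
  shows "real (length (message_code (a, b, c))) \<le> real (Suc (36 * (k + 7))) * log 2 (real n)"
proof -
  let ?X = "n ^ Suc (k + 6)"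
  have pow: "n ^ i \<le> ?X" if "i \<le> k + 7" for i using n that by (intro power_increasing) auto
  have Suc_pow: "Suc x \<le> ?X" if "x \<le> n ^ i" "i \<le> k + 6" for x i
  proof -
    have "0 < n ^ i" using n by simp
    then have "Suc x \<le> n ^ i + n ^ i" using that(1) by linarith
    also have "\<dots> \<le> n * n ^ i" using n by (metis mult_2 mult_le_mono1)
    also have "\<dots> \<le> ?X" using pow[of "Suc i"] that(2) by simp
    finally show ?thesis .
  qed
  have B: "option_code (map_option prod_encode b) \<le> ?X"
  proof (cases b)
    case (Some p)
    then obtain x y where p: "b = Some (x, y)" by (cases p) auto
    have "prod_encode (x, y) \<le> n ^ 6"
      using prod_encode_le_power[OF n, of x 0 y] b[OF p] by simp
    then show ?thesis using p Suc_pow[of _ 6] by (simp add: option_code_def)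
  qed (simp add: option_code_def)
  have C: "option_code (map_option option_code c) \<le> ?X"
  proof (cases c)
    case (Some d)
    have "option_code d \<le> n ^ k"
      using c Some by (cases d) (auto simp: option_code_def Suc_le_eq)
    then show ?thesis using Some Suc_pow[of _ k] by (simp add: option_code_def)
  qed (simp add: option_code_def)
  have "option_code a \<le> ?X"
    using a Suc_pow[of _ k] by (auto simp: option_code_def less_imp_le split: option.splits)
  also have "?X \<le> n ^ Suc (6 * k + 41)" using n by (intro power_increasing) auto
  finally have A: "option_code a \<le> n ^ Suc (6 * k + 41)" .
  have D: "prod_encode (option_code (map_option prod_encode b), option_code (map_option option_code c))
      \<le> n ^ Suc (6 * k + 41)"
    using prod_encode_le_power[OF n B C] by (simp add: algebra_simps del: power_Suc)
  have "prod_encode (option_code a,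
       prod_encode (option_code (map_option prod_encode b), option_code (map_option option_code c)))
     \<le> n ^ (6 * Suc (6 * k + 41))"
    using prod_encode_le_power[OF n A D] .
  also have "6 * Suc (6 * k + 41) = 36 * (k + 7)" by simp
  finally show ?thesis
    using length_bits_le[OF n] by (simp only: message_code_def prod.case)
qed

theorem theorem6:
  fixes k :: nat
  shows "\<exists>(A :: (tap_input, bool list, nat set) dist_algorithm) (c :: real) (C :: nat).
    \<forall>V E T r. tap_instance V E T r \<longrightarrow> (\<forall>v\<in>V. v < card V ^ k) \<longrightarrow>
      message_size_le A E (tap_local_input E T r) (c * log 2 (real (card V))) \<and>
      (\<exists>Aug. tap_approximation 2 V E T Aug \<and>
         computes_within A V E (tap_local_input E T r) (C * height V T r) (incident_part Aug))"
proof -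
  \<comment> \<open>One algorithm for all instances; \<open>k\<close> enters only the length
    bound.\<close>
  obtain A :: "(tap_input, bool list, nat set) dist_algorithm" where A:
    "\<And>E inp t u v.
       (\<And>v. neighbours (inp v) = {u. {u, v} \<in> E} \<and> finite (neighbours (inp v)) \<and>
          finite (tree_neighbours (inp v))) \<Longrightarrow>
       send A (state_after A E inp t v) u
         = Some (message_code (tap_message (inp v) (inbox tap_message E inp t v))) \<and>
       result A (state_after A E inp t v) = tap_result (inp v) (inbox tap_message E inp t v)"
    using broadcast_realizable[OF inj_message_code, of tap_message tap_result] by blast
  let ?c = "real (Suc (36 * (k + 7)))"
  have "message_size_le A E (tap_local_input E T r) (?c * log 2 (real (card V))) \<and>
      (\<exists>Aug. tap_approximation 2 V E T Aug \<and>
         computes_within A V E (tap_local_input E T r) (6 * height V T r) (incident_part Aug))"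
    if inst: "tap_instance V E T r" and id: "\<forall>v\<in>V. v < card V ^ k" for V E T r
  proof -
    interpret tap V E T r by unfold_locales (rule inst)
    have nb: "{u. {u, v} \<in> E} \<subseteq> V" "{u. {u, v} \<in> T} \<subseteq> V" for v
      using edge_D tree_subset by blast+
    have "neighbours (inp v) = {u. {u, v} \<in> E} \<and> finite (neighbours (inp v)) \<and>
          finite (tree_neighbours (inp v))" for v
      using nb[of v] finite_V by (auto simp: inp_simps intro: finite_subset)
    note A = A[of inp, OF this]
    have "message_size_le A E inp (?c * log 2 (real (card V)))"
      unfolding message_size_le_def
    proof (intro allI impI)
      fix t u v m
      assume uv: "{u, v} \<in> E" and m: "send A (state_after A E inp t u) v = Some m"
      \<comment> \<open>Messages travel only along edges, so there are at least two vertices, as the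
        logarithmic bound requires.\<close>
      have V: "u \<in> V" "v \<in> V" "u \<noteq> v" using edge_D[OF uv] by auto
      then have V': "V \<noteq> {r}" by auto
      have "card {u, v} \<le> card V" using V finite_V by (intro card_mono) auto
      then have n: "2 \<le> card V" using V by simp
      have m: "m = message_code (message t u)" using m A by (simp add: message_def)
      obtain a b c where abc: "message t u = (a, b, c)" "set_option a \<subseteq> V"
        "b = None \<or> b = Some (rep u)" "c = None \<or> c = Some None \<or> c = Some (Some (bst u))"
        using message_cases[OF V' V(1)] by blast
      have bst: "bst u \<in> V" using bst_in[OF V(1) V'] cross_D children_D(1) by blast
      show "real (length m) \<le> ?c * log 2 (real (card V))"
        unfolding m abc(1)
      proof (rule length_message_code_le[OF n])
        show "x < card V ^ k" if "a = Some x" for x using that abc id by auto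
        show "x \<le> card V \<and> y \<le> card V" if "b = Some (x, y)" for x y
          using that abc(3) rep_le[OF V' V(1)] by (cases "rep u") auto
        show "x < card V ^ k" if "c = Some (Some x)" for x using that abc(4) bst id by auto
      qed
    qed
    moreover have "computes_within A V E inp (6 * h) (incident_part greedy)"
      unfolding computes_within_def using results_within A by simp
    ultimately show ?thesis using greedy_approximation by blast
  qed
  then show ?thesis by blast
qed

end
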